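(* Let $A$ be an $n$-by-$n$ complex matrix with $n\ge 3$. Then $d(A)=n-1$ if and only if $A$ is unitarily similar to a matrix of the form $B\oplus 0_{n-3}$, where $B$ is a $3$-by-$3$ matrix such that either (i) the numerical range $W(B)$ is an elliptic disc and the eigenvalues of $B$ (counting algebraic multiplicity) are $0$ and the two foci of the ellipse $\partial W(B)$, or (ii) $W(B)$ is a (nondegenerate) line segment and the eigenvalues of $B$ (counting algebraic multiplicity) are $0$ and the two endpoints of $W(B)$.
   Context: For an $n$-by-$n$ complex matrix $A$, the zero-dilation index $d(A)$ is the largest integer $k\ge 1$ such that there is an $n$-by-$k$ complex matrix $V$ with $V^*V=I_k$ and $V^*AV=0_k$, where $0_k$ is the $k$-by-$k$ zero matrix; if no such $k$ exists, $d(A)=0$. The numerical range of $B$ is $W(B)=\{\langle Bx,x\rangle : x\in\mathbb{C}^3,\ \|x\|=1\}$. An elliptic disc is the closed region of the plane bounded by a nondegenerate ellipse; circles are allowed, in which case the two foci both equal the center. *)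

theory Defs
  imports
    "Jordan_Normal_Form.Schur_Decomposition"
    "HOL-Computational_Algebra.Fundamental_Theorem_Algebra"
    "HOL-Analysis.Line_Segment"
begin

definition zero_compression :: "complex mat \<Rightarrow> nat \<Rightarrow> bool" where
  "zero_compression A k \<longleftrightarrow>
     (\<exists>V \<in> carrier_mat (dim_row A) k.
        mat_adjoint V * V = 1\<^sub>m k \<and> mat_adjoint V * A * V = 0\<^sub>m k k)"

text \<open>The maximum below exists: an isometry \<open>V\<close> with \<open>k\<close> columns
  and \<open>n\<close> rows has \<open>k \<le> n\<close>.\<close>

definition zero_dilation_index :: "complex mat \<Rightarrow> nat" where
  "zero_dilation_index A =
     (if \<exists>k\<ge>1. zero_compression A k
      then GREATEST k. k \<ge> 1 \<and> zero_compression A k else 0)"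

definition unitarily_similar :: "nat \<Rightarrow> complex mat \<Rightarrow> complex mat \<Rightarrow> bool" where
  "unitarily_similar n A B \<longleftrightarrow>
     A \<in> carrier_mat n n \<and> B \<in> carrier_mat n n \<and>
     (\<exists>U \<in> carrier_mat n n.
        mat_adjoint U * U = 1\<^sub>m n \<and> U * mat_adjoint U = 1\<^sub>m n \<and>
        A = mat_adjoint U * B * U)"

text \<open>Here \<open>x \<bullet>c y\<close> is linear in \<open>x\<close> and conjugate-linear in \<open>y\<close>;
  the condition \<open>x \<bullet>c x = 1\<close> says that \<open>x\<close> has Euclidean norm 1.\<close>

definition numerical_range :: "complex mat \<Rightarrow> complex set" where
  "numerical_range B =
     {(B *\<^sub>v x) \<bullet>c x | x. x \<in> carrier_vec (dim_row B) \<and> x \<bullet>c x = 1}"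

text \<open>Closed elliptic disc with foci \<open>f\<^sub>1\<close>, \<open>f\<^sub>2\<close>: the bounding ellipse is the set of points
  whose distances to the foci add up to the major axis length \<open>s\<close>. It is nondegenerate
  iff \<open>s\<close> exceeds the focal distance, and a circle iff \<open>f\<^sub>1 = f\<^sub>2\<close>.\<close>

definition elliptic_disc_with_foci :: "complex set \<Rightarrow> complex \<Rightarrow> complex \<Rightarrow> bool" where
  "elliptic_disc_with_foci S f\<^sub>1 f\<^sub>2 \<longleftrightarrow>
     (\<exists>s > dist f\<^sub>1 f\<^sub>2. S = {z. dist z f\<^sub>1 + dist z f\<^sub>2 \<le> s})"

definition eigenvalue_mset :: "complex mat \<Rightarrow> complex multiset" where
  "eigenvalue_mset B = proots (char_poly B)"

end

theory Submission
  imports Defs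
begin

text \<open>If \<open>d(A) = n - 1\<close> then \<open>A\<close> vanishes as a form on a hyperplane, so in an orthonormal basis
  starting with the normal vector only the first row and column survive, and two Householder
  reflections leave a \<open>3 \<times> 3\<close> block \<open>B\<close>. The Hopf map turns \<open>W(B)\<close> into the image of the unit
  sphere of \<open>\<real>\<^sup>5\<close> under an affine map with coefficients \<open>c\<^sub>j / 2\<close>; this is an ellipse or a segment
  whose foci are read off from \<open>\<Sum>c\<^sub>j\<^sup>2\<close> and turn out to be the roots of the characteristic
  polynomial other than the obvious root \<open>0\<close>.

  Conversely only the symmetry of \<open>W(B)\<close> about half the trace is needed: it forces \<open>0\<close> to be an
  eigenvalue of all Hermitian parts of \<open>e\<^sup>i\<^sup>\<theta> B\<close>. Applied to \<open>B\<close> and \<open>\<i>B\<close>, in a basis starting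
  with a kernel vector \<open>x\<close> of \<open>B\<close>, this is exactly the equation saying that the vector \<open>y\<close> orthogonal
  to \<open>x\<close> with \<open>By\<close> orthogonal to \<open>x\<close> is isotropic; so \<open>B\<close> compresses to zero on the span of \<open>x\<close> and \<open>y\<close>.\<close>

hide_const (open) Finite_Cartesian_Product.mat Finite_Cartesian_Product.vec Finite_Cartesian_Product.row
hide_type (open) Finite_Cartesian_Product.vec
unbundle no vec_syntax and no inner_syntax

section \<open>Ellipses as linear images of balls\<close>

lemma unimodular_rotation:
  fixes D :: complex
  obtains w where "norm w = 1" "w * D = of_real (norm D)"
proof (cases "D = 0")
  case True
  then show ?thesis using that[of 1] by simp
next
  case False
  then have "cnj D / of_real (norm D) * D = of_real (norm D)"
    using complex_norm_square[of D] by (simp add: power2_eq_square field_simps)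
  moreover have "norm (cnj D / of_real (norm D)) = 1"
    using False by (simp add: norm_divide)
  ultimately show ?thesis using that by blast
qed

text \<open>Multiplying every \<open>c j\<close> by \<open>w\<close> multiplies the sum of their
  squares by \<open>w\<^sup>2\<close>, so it is the square of the phase that has to be
  prescribed.\<close>

lemma unimodular_square_rotation:
  fixes D :: complex
  obtains w where "norm w = 1" "w\<^sup>2 * D = of_real (norm D)"
proof -
  obtain u where u: "norm u = 1" "u * D = of_real (norm D)"
    by (rule unimodular_rotation)
  have "norm (csqrt u) = 1"
    using u(1) by (metis norm_power power2_csqrt power2_eq_1_iff norm_ge_zero abs_norm_cancel real_sqrt_abs real_sqrt_one)
  then show ?thesis using that[of "csqrt u"] u(2) by simp
qed

text \<open>With \<open>G = \<Sum>c\<^sub>j\<^sup>2\<close> and \<open>N = \<Sum>|c\<^sub>j|\<^sup>2\<close>, the condition \<open>|z\<^sup>2 - G| \<le> N - |z|\<^sup>2\<close> says that the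
  distances of \<open>z\<close> to the two square roots of \<open>G\<close> add up to at most \<open>sqrt (2 * (N + |G|))\<close>.
  After multiplying all \<open>c\<^sub>j\<close> by a suitable unimodular number only a
  Cauchy-Schwarz estimate for the imaginary parts is left.\<close>

lemma linear_image_ball_le:
  fixes c :: "'i \<Rightarrow> complex" and x :: "'i \<Rightarrow> real"
  assumes x: "(\<Sum>j\<in>I. (x j)\<^sup>2) \<le> 1"
  defines "z \<equiv> \<Sum>j\<in>I. of_real (x j) * c j"
  shows "norm (z\<^sup>2 - (\<Sum>j\<in>I. (c j)\<^sup>2)) \<le> (\<Sum>j\<in>I. (norm (c j))\<^sup>2) - (norm z)\<^sup>2"
proof -
  define G where "G = (\<Sum>j\<in>I. (c j)\<^sup>2)"
  \<comment> \<open>With this phase the norm of \<open>G - z\<^sup>2\<close> is a real part, and the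
    claim reduces to \<open>B\<^sup>2\<close> being at most the sum of the
    \<open>(b j)\<^sup>2\<close>.\<close>
  obtain w where w: "norm w = 1" "w\<^sup>2 * (G - z\<^sup>2) = of_real (norm (G - z\<^sup>2))"
    by (rule unimodular_square_rotation)
  define a where "a = (\<lambda>j. Re (w * c j))"
  define b where "b = (\<lambda>j. Im (w * c j))"
  define A where "A = (\<Sum>j\<in>I. x j * a j)"
  define B where "B = (\<Sum>j\<in>I. x j * b j)"
  have wz: "w * z = (\<Sum>j\<in>I. of_real (x j) * (w * c j))"
    by (simp add: z_def sum_distrib_left algebra_simps)
  have Re: "Re (w * z) = A" and Im: "Im (w * z) = B"
    unfolding wz A_def B_def a_def b_def by simp_all
  have "w\<^sup>2 * G = (\<Sum>j\<in>I. (w * c j)\<^sup>2)"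
    by (simp add: G_def sum_distrib_left power_mult_distrib)
  then have ReG: "Re (w\<^sup>2 * G) = (\<Sum>j\<in>I. (a j)\<^sup>2) - (\<Sum>j\<in>I. (b j)\<^sup>2)"
    by (simp add: a_def b_def sum_subtractf Re_power2)
  have N: "(\<Sum>j\<in>I. (norm (c j))\<^sup>2) = (\<Sum>j\<in>I. (a j)\<^sup>2) + (\<Sum>j\<in>I. (b j)\<^sup>2)"
  proof -
    have "(norm (c j))\<^sup>2 = (a j)\<^sup>2 + (b j)\<^sup>2" for j
      using w(1) cmod_power2[of "w * c j"] by (simp add: a_def b_def norm_mult)
    then show ?thesis by (simp add: sum.distrib)
  qed
  have "(norm z)\<^sup>2 = (norm (w * z))\<^sup>2" using w(1) by (simp add: norm_mult)
  then have nz: "(norm z)\<^sup>2 = A\<^sup>2 + B\<^sup>2" unfolding cmod_power2 Re Im .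
  have "norm (G - z\<^sup>2) = Re (w\<^sup>2 * (G - z\<^sup>2))" using w(2) by simp
  also have "\<dots> = Re (w\<^sup>2 * G) - Re ((w * z)\<^sup>2)"
    by (simp add: algebra_simps power_mult_distrib)
  also have "\<dots> = (\<Sum>j\<in>I. (a j)\<^sup>2) - (\<Sum>j\<in>I. (b j)\<^sup>2) - (A\<^sup>2 - B\<^sup>2)"
    unfolding ReG by (simp only: Re Im Re_power2)
  finally have *: "norm (G - z\<^sup>2) = (\<Sum>j\<in>I. (a j)\<^sup>2) - (\<Sum>j\<in>I. (b j)\<^sup>2) - (A\<^sup>2 - B\<^sup>2)" .
  have "B\<^sup>2 \<le> (\<Sum>j\<in>I. (x j)\<^sup>2) * (\<Sum>j\<in>I. (b j)\<^sup>2)"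
    unfolding B_def by (rule Cauchy_Schwarz_ineq_sum)
  also have "\<dots> \<le> 1 * (\<Sum>j\<in>I. (b j)\<^sup>2)"
    by (intro mult_right_mono x sum_nonneg) simp_all
  finally show ?thesis
    using * N nz by (simp add: G_def norm_minus_commute)
qed

text \<open>Once the sum of the \<open>(w * c j)\<^sup>2\<close> is real and nonnegative, the
  vectors \<open>a\<close> and \<open>b\<close> of real and imaginary parts are orthogonal. The
  rotated image of the ball is then an ellipse along the coordinate axes with squared semi-axes
  \<open>P\<close> and \<open>Q\<close>, and a preimage is found in the span of \<open>a\<close> and
  \<open>b\<close>.\<close>

lemma linear_image_ball_ge:
  fixes c :: "'i \<Rightarrow> complex"
  assumes z: "norm (z\<^sup>2 - (\<Sum>j\<in>I. (c j)\<^sup>2)) \<le> (\<Sum>j\<in>I. (norm (c j))\<^sup>2) - (norm z)\<^sup>2"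
  shows "\<exists>x. (\<Sum>j\<in>I. (x j)\<^sup>2) \<le> 1 \<and> z = (\<Sum>j\<in>I. of_real (x j) * c j)"
proof -
  define G where "G = (\<Sum>j\<in>I. (c j)\<^sup>2)"
  obtain w where w: "norm w = 1" "w\<^sup>2 * G = of_real (norm G)"
    by (rule unimodular_square_rotation)
  define a where "a = (\<lambda>j. Re (w * c j))"
  define b where "b = (\<lambda>j. Im (w * c j))"
  define P where "P = (\<Sum>j\<in>I. (a j)\<^sup>2)"
  define Q where "Q = (\<Sum>j\<in>I. (b j)\<^sup>2)"
  define A where "A = Re (w * z)"
  define B where "B = Im (w * z)"
  have pos: "P \<ge> 0" "Q \<ge> 0" by (simp_all add: P_def Q_def sum_nonneg)
  have "w\<^sup>2 * G = (\<Sum>j\<in>I. (w * c j)\<^sup>2)"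
    by (simp add: G_def sum_distrib_left power_mult_distrib)
  then have wG: "of_real (norm G) = (\<Sum>j\<in>I. (w * c j)\<^sup>2)" using w(2) by simp
  have PQ: "norm G = P - Q"
    using arg_cong[OF wG, of Re] by (simp add: a_def b_def P_def Q_def sum_subtractf Re_power2)
  have orth: "(\<Sum>j\<in>I. a j * b j) = 0"
    using arg_cong[OF wG, of Im]
    by (simp only: a_def b_def Im_power2 Im_sum Im_complex_of_real mult.assoc sum_distrib_left[symmetric])
  have N: "(\<Sum>j\<in>I. (norm (c j))\<^sup>2) = P + Q"
  proof -
    have "(norm (c j))\<^sup>2 = (a j)\<^sup>2 + (b j)\<^sup>2" for j
      using w(1) cmod_power2[of "w * c j"] by (simp add: a_def b_def norm_mult)
    then show ?thesis by (simp add: sum.distrib P_def Q_def)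
  qed
  have nz: "(norm z)\<^sup>2 = A\<^sup>2 + B\<^sup>2"
    using w(1) cmod_power2[of "w * z"] by (simp add: norm_mult A_def B_def)
  have "norm (z\<^sup>2 - G) = norm (w\<^sup>2 * (z\<^sup>2 - G))"
    using w(1) by (simp add: norm_mult norm_power)
  also have "w\<^sup>2 * (z\<^sup>2 - G) = (w * z)\<^sup>2 - of_real (P - Q)"
    using w(2) PQ by (simp add: algebra_simps power_mult_distrib)
  also have "\<dots> = Complex (A\<^sup>2 - B\<^sup>2 - (P - Q)) (2 * A * B)"
    by (simp add: complex_eq_iff A_def B_def Re_power2 Im_power2)
  finally have "norm (Complex (A\<^sup>2 - B\<^sup>2 - (P - Q)) (2 * A * B)) \<le> P + Q - (A\<^sup>2 + B\<^sup>2)"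
    using z by (simp add: G_def N nz)
  then have le: "A\<^sup>2 + B\<^sup>2 \<le> P + Q"
    and sq: "(A\<^sup>2 - B\<^sup>2 - (P - Q))\<^sup>2 + (2 * A * B)\<^sup>2 \<le> (P + Q - (A\<^sup>2 + B\<^sup>2))\<^sup>2"
    using norm_ge_zero order_trans abs_le_square_iff
    by (smt (verit), metis cmod_power2 complex.sel norm_ge_zero power_mono)
  \<comment> \<open>For positive \<open>P\<close> and \<open>Q\<close> this is the inequality
    \<open>A\<^sup>2 / P + B\<^sup>2 / Q \<le> 1\<close> of the ellipse with denominators
    cleared.\<close>
  have *: "A\<^sup>2 * Q + B\<^sup>2 * P \<le> P * Q"
    using sq by (simp add: power2_eq_square algebra_simps)
  have A0: "A = 0" if "P = 0"
    using that * le pos by (smt (verit) PQ norm_ge_zero power2_less_0 zero_eq_power2)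
  have B0: "B = 0" if "Q = 0"
  proof (rule ccontr)
    assume "B \<noteq> 0"
    then have "P = 0" using * that pos by (simp add: mult_le_0_iff)
    then show False using le \<open>B \<noteq> 0\<close> that by (smt (verit) power2_less_0 zero_eq_power2)
  qed
  \<comment> \<open>By orthogonality these are the coordinates of a preimage with respect to
    \<open>a\<close> and \<open>b\<close>. If \<open>P\<close> or \<open>Q\<close> is
    \<open>0\<close>, the quotient is \<open>0\<close> by convention, which is consistent by
    \<open>A0\<close> and \<open>B0\<close>.\<close>
  define e f where "e = A / P" and "f = B / Q"
  define x where "x = (\<lambda>j. e * a j + f * b j)"
  have s1: "(\<Sum>j\<in>I. x j * a j) = e * P + f * (\<Sum>j\<in>I. a j * b j)"
    by (simp add: x_def P_def sum.distrib sum_distrib_left algebra_simps power2_eq_square)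
  have s2: "(\<Sum>j\<in>I. x j * b j) = e * (\<Sum>j\<in>I. a j * b j) + f * Q"
    by (simp add: x_def Q_def sum.distrib sum_distrib_left algebra_simps power2_eq_square)
  have sA: "(\<Sum>j\<in>I. x j * a j) = A" using s1 orth A0 by (auto simp: e_def)
  have sB: "(\<Sum>j\<in>I. x j * b j) = B" using s2 orth B0 by (auto simp: f_def)
  have "(\<Sum>j\<in>I. (x j)\<^sup>2) = (\<Sum>j\<in>I. e * (x j * a j) + f * (x j * b j))"
    by (rule sum.cong) (simp_all add: x_def power2_eq_square algebra_simps)
  also have "\<dots> = e * A + f * B"
    by (simp add: sum.distrib sA sB flip: sum_distrib_left)
  also have "\<dots> \<le> 1"
  proof (cases "P = 0 \<or> Q = 0")
    case False
    then have "P > 0" "Q > 0" using pos by auto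
    then show ?thesis using * by (simp add: e_def f_def field_simps power2_eq_square)
  next
    case True
    then consider "P = 0" "Q = 0" | "P = 0" "Q > 0" | "Q = 0" "P > 0" using pos by linarith
    then show ?thesis
    proof cases
      case 2
      then have False using PQ by (smt (verit) norm_ge_zero)
      then show ?thesis ..
    next
      \<comment> \<open>Here \<open>*\<close> gives no bound on \<open>A\<close>; with
        \<open>B = 0\<close> the estimate \<open>le\<close> supplies
        \<open>A\<^sup>2 \<le> P\<close>.\<close>
      case 3
      then show ?thesis using B0 le by (simp add: e_def f_def field_simps power2_eq_square)
    qed (simp add: e_def f_def)
  qed
  finally have xs: "(\<Sum>j\<in>I. (x j)\<^sup>2) \<le> 1" .
  have "w * z = (\<Sum>j\<in>I. of_real (x j) * (w * c j))"
    using sA sB by (simp add: complex_eq_iff A_def B_def a_def b_def)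
  also have "\<dots> = w * (\<Sum>j\<in>I. of_real (x j) * c j)"
    by (simp add: sum_distrib_left algebra_simps)
  finally have "z = (\<Sum>j\<in>I. of_real (x j) * c j)" using w(1) by auto
  then show ?thesis using xs by blast
qed

text \<open>A real linear relation \<open>k\<close> among the \<open>c j\<close> is a direction
  along which \<open>x\<close> moves without changing its image, so a point of the ball can be
  pushed to the sphere. Hence ball and sphere have the same image.\<close>

lemma linear_image_sphere:
  fixes c :: "'i \<Rightarrow> complex"
  assumes I: "finite I" and k: "(\<Sum>j\<in>I. of_real (k j) * c j) = 0" "j0 \<in> I" "k j0 \<noteq> 0"
  shows "(\<exists>x. (\<Sum>j\<in>I. (x j)\<^sup>2) = 1 \<and> z = (\<Sum>j\<in>I. of_real (x j) * c j)) \<longleftrightarrow>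
    norm (z\<^sup>2 - (\<Sum>j\<in>I. (c j)\<^sup>2)) \<le> (\<Sum>j\<in>I. (norm (c j))\<^sup>2) - (norm z)\<^sup>2" (is "?L \<longleftrightarrow> ?R")
proof
  assume ?L
  then obtain x where x: "(\<Sum>j\<in>I. (x j)\<^sup>2) = 1" "z = (\<Sum>j\<in>I. of_real (x j) * c j)"
    by blast
  show ?R unfolding x(2) by (rule linear_image_ball_le) (simp add: x(1))
next
  assume ?R
  then obtain x where x: "(\<Sum>j\<in>I. (x j)\<^sup>2) \<le> 1" "z = (\<Sum>j\<in>I. of_real (x j) * c j)"
    using linear_image_ball_ge by blast
  define K where "K = (\<Sum>j\<in>I. (k j)\<^sup>2)"
  define X where "X = (\<Sum>j\<in>I. (x j)\<^sup>2)"
  define M where "M = (\<Sum>j\<in>I. x j * k j)"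
  have K: "K > 0" unfolding K_def using I k(2,3) by (intro sum_pos2[of _ j0]) auto
  \<comment> \<open>A quarter of the discriminant of
    \<open>K * t\<^sup>2 + 2 * t * M + X = 1\<close>, the equation that puts \<open>x + t k\<close>
    on the sphere; it is nonnegative since \<open>X \<le> 1\<close>. The \<open>t\<close> below is
    the larger root.\<close>
  define D where "D = M\<^sup>2 + K * (1 - X)"
  have D: "D \<ge> 0" using K x(1) by (auto simp: D_def X_def)
  define t where "t = (sqrt D - M) / K"
  define y where "y = (\<lambda>j. x j + t * k j)"
  have "K * t + M = sqrt D" using K by (simp add: t_def)
  then have "(K * t + M)\<^sup>2 = D" using D by simp
  then have "K * (K * t\<^sup>2 + 2 * t * M + X) = K * 1"
    by (simp add: D_def power2_eq_square algebra_simps)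
  then have "K * t\<^sup>2 + 2 * t * M + X = 1" using K mult_cancel_left by (metis less_irrefl)
  moreover have "(\<Sum>j\<in>I. (y j)\<^sup>2) = K * t\<^sup>2 + 2 * t * M + X"
    by (simp add: y_def K_def M_def X_def power2_sum sum.distrib sum_distrib_left sum_distrib_right
        power_mult_distrib algebra_simps)
  moreover have "(\<Sum>j\<in>I. of_real (y j) * c j) = z + of_real t * (\<Sum>j\<in>I. of_real (k j) * c j)"
    by (simp add: y_def x(2) algebra_simps sum.distrib sum_distrib_left)
  ultimately show ?L using k(1) by (intro exI[of _ y]) simp
qed

text \<open>On the vectors \<open>s z + w z'\<close> with \<open>z' = (- cnj z\<^sub>2, cnj z\<^sub>1)\<close>, real \<open>s\<close> and a suitable fixed phase \<open>w\<close>,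
  the form divided by \<open>\<alpha>\<close> is a real quadratic polynomial in \<open>s\<close> with nonnegative discriminant.\<close>

lemma binary_form_zero:
  fixes p d g q z1 z2 \<alpha> :: complex and \<kappa> :: real
  defines "Q \<equiv> \<lambda>w1 w2. p * (w1 * cnj w1) + d * (w2 * cnj w1) + g * (w1 * cnj w2) + q * (w2 * cnj w2)"
  assumes nz: "z1 \<noteq> 0 \<or> z2 \<noteq> 0" and z: "Q z1 z2 = \<alpha>"
    and z': "Q (- cnj z2) (cnj z1) = - of_real \<kappa> * \<alpha>" and \<kappa>: "\<kappa> \<ge> 0"
  shows "\<exists>y1 y2. (y1 \<noteq> 0 \<or> y2 \<noteq> 0) \<and> Q y1 y2 = 0"
proof (cases "\<alpha> = 0")
  case True
  then show ?thesis using nz z by blast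
next
  case False
  define u1 where "u1 = - cnj z2"
  define u2 where "u2 = cnj z1"
  define X where "X = (p * (u1 * cnj z1) + d * (u2 * cnj z1) + g * (u1 * cnj z2) + q * (u2 * cnj z2)) / \<alpha>"
  define Y where "Y = (p * (z1 * cnj u1) + d * (z2 * cnj u1) + g * (z1 * cnj u2) + q * (z2 * cnj u2)) / \<alpha>"
  have X\<alpha>: "X * \<alpha> = p * (u1 * cnj z1) + d * (u2 * cnj z1) + g * (u1 * cnj z2) + q * (u2 * cnj z2)"
    and Y\<alpha>: "Y * \<alpha> = p * (z1 * cnj u1) + d * (z2 * cnj u1) + g * (z1 * cnj u2) + q * (z2 * cnj u2)"
    using False by (simp_all add: X_def Y_def)
  \<comment> \<open>\<open>X\<close> and \<open>Y\<close> are the mixed terms of the form between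
    \<open>z\<close> and \<open>u\<close>, divided by \<open>\<alpha>\<close>. The phase makes
    \<open>w * X + cnj w * Y\<close> real, because its imaginary part is that of
    \<open>w * (X - cnj Y)\<close>.\<close>
  obtain w where w: "norm w = 1" "w * (X - cnj Y) = of_real (norm (X - cnj Y))"
    by (rule unimodular_rotation)
  define m where "m = Re (w * X + cnj w * Y)"
  have "Im (w * X + cnj w * Y) = Im (w * (X - cnj Y))" by (simp add: algebra_simps)
  also have "\<dots> = 0" using w(2) by simp
  finally have m: "w * X + cnj w * Y = of_real m" by (simp add: m_def complex_eq_iff)
  have ww: "w * cnj w = 1" using w(1) by (simp add: complex_norm_square[symmetric])
  define s where "s = (sqrt (m\<^sup>2 + 4 * \<kappa>) - m) / 2"
  have "2 * s + m = sqrt (m\<^sup>2 + 4 * \<kappa>)" by (simp add: s_def field_simps)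
  then have "(2 * s + m)\<^sup>2 = m\<^sup>2 + 4 * \<kappa>" using \<kappa> by simp
  then have s: "s\<^sup>2 + s * m - \<kappa> = 0" by (simp add: power2_eq_square algebra_simps)
  define y1 where "y1 = of_real s * z1 + w * u1"
  define y2 where "y2 = of_real s * z2 + w * u2"
  have "Q y1 y2 = of_real s * of_real s * Q z1 z2 + (w * cnj w) * Q u1 u2
      + of_real s * (w * (X * \<alpha>) + cnj w * (Y * \<alpha>))"
    unfolding X\<alpha> Y\<alpha> by (simp add: Q_def y1_def y2_def algebra_simps)
  also have "\<dots> = of_real s * of_real s * \<alpha> + (w * cnj w) * (- of_real \<kappa> * \<alpha>)
      + of_real s * ((w * X + cnj w * Y) * \<alpha>)"
    using z z' by (simp add: u1_def u2_def algebra_simps)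
  also have "\<dots> = \<alpha> * of_real (s\<^sup>2 + s * m - \<kappa>)"
    unfolding m ww by (simp add: algebra_simps power2_eq_square)
  also have "\<dots> = 0" by (simp add: s)
  finally have "Q y1 y2 = 0" .
  \<comment> \<open>The vectors \<open>(z1, z2)\<close> and \<open>(u1, u2)\<close> are orthogonal
    and nonzero, and \<open>w\<close> is not \<open>0\<close>; pairing with \<open>u\<close> shows
    that the combination cannot vanish.\<close>
  moreover have "y1 \<noteq> 0 \<or> y2 \<noteq> 0"
  proof (rule ccontr)
    assume "\<not> ?thesis"
    then have "of_real s * z1 = - (w * u1)" "of_real s * z2 = - (w * u2)"
      by (auto simp: y1_def y2_def eq_neg_iff_add_eq_0)
    then have "of_real s * z1 * cnj u1 + of_real s * z2 * cnj u2 = - w * (u1 * cnj u1 + u2 * cnj u2)"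
      by (simp add: algebra_simps)
    moreover have "of_real s * z1 * cnj u1 + of_real s * z2 * cnj u2 = 0"
      by (simp add: u1_def u2_def)
    ultimately have "u1 * cnj u1 + u2 * cnj u2 = 0" using w(1) by auto
    then have "complex_of_real ((norm z2)\<^sup>2 + (norm z1)\<^sup>2) = 0"
      by (simp add: u1_def u2_def complex_norm_square[symmetric] mult.commute of_real_add)
    then have "(norm z2)\<^sup>2 + (norm z1)\<^sup>2 = 0" by (simp only: of_real_eq_0_iff)
    then show False using nz by (simp add: sum_power2_eq_zero_iff)
  qed
  ultimately show ?thesis by blast
qed

section \<open>Unitary similarity and compressions\<close>

lemma dim_mat_adjoint [simp]:
  "dim_row (mat_adjoint A) = dim_col A" "dim_col (mat_adjoint A) = dim_row A"
  by (simp_all add: mat_adjoint_def)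

lemma mat_adjoint_carrier [simp]: "A \<in> carrier_mat m n \<Longrightarrow> mat_adjoint A \<in> carrier_mat n m"
  by (metis carrier_matD carrier_matI dim_mat_adjoint)

lemma index_mat_adjoint [simp]:
  fixes A :: "complex mat"
  assumes "i < dim_col A" "j < dim_row A"
  shows "mat_adjoint A $$ (i, j) = cnj (A $$ (j, i))"
  using assms by (simp add: mat_adjoint_def mat_of_rows_index)

lemma mat_adjoint_adjoint [simp]: "mat_adjoint (mat_adjoint A) = (A :: complex mat)"
  by (rule eq_matI) simp_all

lemma mat_adjoint_mult:
  fixes A B :: "complex mat"
  assumes "A \<in> carrier_mat m k" "B \<in> carrier_mat k n"
  shows "mat_adjoint (A * B) = mat_adjoint B * mat_adjoint A"
  using assms by (intro eq_matI) (auto simp: scalar_prod_def intro!: sum.cong)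

lemma mat_adjoint_one [simp]: "mat_adjoint (1\<^sub>m n :: complex mat) = 1\<^sub>m n"
  by (rule eq_matI) auto

lemma mat_adjoint_four_block:
  fixes A B C D :: "complex mat"
  assumes "A \<in> carrier_mat nr1 nc1" "B \<in> carrier_mat nr1 nc2"
    "C \<in> carrier_mat nr2 nc1" "D \<in> carrier_mat nr2 nc2"
  shows "mat_adjoint (four_block_mat A B C D) =
    four_block_mat (mat_adjoint A) (mat_adjoint C) (mat_adjoint B) (mat_adjoint D)"
  using assms by (intro eq_matI) auto

lemma cscalar_prod_adjoint:
  fixes A :: "complex mat"
  assumes A: "A \<in> carrier_mat m n" and x: "x \<in> carrier_vec n" and y: "y \<in> carrier_vec m"
  shows "(A *\<^sub>v x) \<bullet>c y = x \<bullet>c (mat_adjoint A *\<^sub>v y)"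
proof -
  have "(A *\<^sub>v x) \<bullet>c y = (\<Sum>i<m. \<Sum>j<n. A $$ (i,j) * x $ j * cnj (y $ i))"
    using assms by (simp add: scalar_prod_def sum_distrib_right atLeast0LessThan)
  also have "\<dots> = (\<Sum>j<n. \<Sum>i<m. A $$ (i,j) * x $ j * cnj (y $ i))" by (rule sum.swap)
  also have "\<dots> = x \<bullet>c (mat_adjoint A *\<^sub>v y)"
    using assms by (auto simp: scalar_prod_def sum_distrib_left atLeast0LessThan algebra_simps
        intro!: sum.cong)
  finally show ?thesis .
qed

definition unitary_mat :: "nat \<Rightarrow> complex mat \<Rightarrow> bool" where
  "unitary_mat n U \<longleftrightarrow>
     U \<in> carrier_mat n n \<and> mat_adjoint U * U = 1\<^sub>m n \<and> U * mat_adjoint U = 1\<^sub>m n"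

lemma unitary_matI:
  assumes "U \<in> carrier_mat n n" "mat_adjoint U * U = 1\<^sub>m n"
  shows "unitary_mat n U"
  using assms mat_mult_left_right_inverse[of "mat_adjoint U" n U] by (simp add: unitary_mat_def)

lemma unitary_matD:
  assumes "unitary_mat n U"
  shows "U \<in> carrier_mat n n" "mat_adjoint U * U = 1\<^sub>m n" "U * mat_adjoint U = 1\<^sub>m n"
  using assms by (simp_all add: unitary_mat_def)

lemma unitary_mat_adjoint: "unitary_mat n U \<Longrightarrow> unitary_mat n (mat_adjoint U)"
  by (simp add: unitary_mat_def)

lemma unitary_mat_one: "unitary_mat n (1\<^sub>m n)"
  by (simp add: unitary_mat_def)

lemma unitary_mat_mult:
  assumes "unitary_mat n U" "unitary_mat n V"
  shows "unitary_mat n (U * V)"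
proof (rule unitary_matI)
  note U = unitary_matD[OF assms(1)] and V = unitary_matD[OF assms(2)]
  show "U * V \<in> carrier_mat n n" using U V by simp
  have "mat_adjoint (U * V) * (U * V) = mat_adjoint V * (mat_adjoint U * (U * V))"
    using U V by (simp add: mat_adjoint_mult[of U n n V n] assoc_mult_mat[of _ n n _ n _ n])
  also have "mat_adjoint U * (U * V) = V"
    using U V by (simp add: assoc_mult_mat[of _ n n _ n _ n, symmetric])
  finally show "mat_adjoint (U * V) * (U * V) = 1\<^sub>m n" using V by simp
qed

text \<open>\<open>V\<close> may be rectangular, so that one identity serves both the composition of
  unitary similarities and the transport of compressions.\<close>

lemma conjugation_assoc:
  fixes A U V :: "complex mat"
  assumes "A \<in> carrier_mat n n" "U \<in> carrier_mat n n" "V \<in> carrier_mat n m"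
  shows "mat_adjoint (U * V) * A * (U * V) = mat_adjoint V * (mat_adjoint U * A * U) * V"
proof -
  have "mat_adjoint (U * V) * A * (U * V) = mat_adjoint V * mat_adjoint U * A * (U * V)"
    using assms by (simp add: mat_adjoint_mult[of U n n V m])
  also have "\<dots> = mat_adjoint V * (mat_adjoint U * (A * (U * V)))"
    using assms by (simp add: assoc_mult_mat[of _ m n _ n _ n] assoc_mult_mat[of _ m n _ n _ m]
        assoc_mult_mat[of _ n n _ n _ m] mult_carrier_mat[of _ n n _ m] mult_carrier_mat[of _ n n _ n])
  also have "\<dots> = mat_adjoint V * (mat_adjoint U * A * U) * V"
    using assms by (simp add: assoc_mult_mat[of _ m n _ n _ n] assoc_mult_mat[of _ m n _ n _ m]
        assoc_mult_mat[of _ n n _ n _ m] mult_carrier_mat[of _ n n _ m] mult_carrier_mat[of _ n n _ n])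
  finally show ?thesis .
qed

lemma unitary_conjugation_cancel:
  assumes "unitary_mat n U" "A \<in> carrier_mat n n"
  shows "U * (mat_adjoint U * A * U) * mat_adjoint U = A"
proof -
  note U = unitary_matD[OF assms(1)]
  have "mat_adjoint (U * mat_adjoint U) * A * (U * mat_adjoint U) =
      mat_adjoint (mat_adjoint U) * (mat_adjoint U * A * U) * mat_adjoint U"
    by (rule conjugation_assoc) (use U assms in auto)
  then show ?thesis using U assms by simp
qed

lemma unitarily_similar_iff:
  "unitarily_similar n A B \<longleftrightarrow>
     B \<in> carrier_mat n n \<and> (\<exists>U. unitary_mat n U \<and> A = mat_adjoint U * B * U)"
  by (auto simp: unitarily_similar_def unitary_mat_def Bex_def)

lemma unitarily_similar_sym:
  assumes "unitarily_similar n A B"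
  shows "unitarily_similar n B A"
proof -
  obtain U where B: "B \<in> carrier_mat n n" and U: "unitary_mat n U" and A: "A = mat_adjoint U * B * U"
    using assms by (auto simp: unitarily_similar_iff)
  have "B = U * A * mat_adjoint U" using unitary_conjugation_cancel[OF U B] by (simp add: A)
  moreover have "A \<in> carrier_mat n n" using A B unitary_matD(1)[OF U] by auto
  ultimately show ?thesis using unitary_mat_adjoint[OF U] unfolding unitarily_similar_iff
    by (metis mat_adjoint_adjoint)
qed

lemma unitarily_similar_trans:
  assumes "unitarily_similar n A B" "unitarily_similar n B C"
  shows "unitarily_similar n A C"
proof -
  obtain U where U: "unitary_mat n U" and A: "A = mat_adjoint U * B * U"
    using assms by (auto simp: unitarily_similar_iff)
  obtain V where C: "C \<in> carrier_mat n n" and V: "unitary_mat n V" and B: "B = mat_adjoint V * C * V"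
    using assms by (auto simp: unitarily_similar_iff)
  have "A = mat_adjoint (V * U) * C * (V * U)"
    unfolding A B by (rule conjugation_assoc[symmetric]) (use U V C in \<open>auto dest: unitary_matD\<close>)
  then show ?thesis using C unitary_mat_mult[OF V U] by (auto simp: unitarily_similar_iff)
qed

lemma unitarily_similar_conjugate:
  assumes "A \<in> carrier_mat n n" "unitary_mat n U"
  shows "unitarily_similar n A (U * A * mat_adjoint U)"
proof (rule unitarily_similar_sym)
  show "unitarily_similar n (U * A * mat_adjoint U) A"
    using assms unitary_mat_adjoint[OF assms(2)] unfolding unitarily_similar_iff
    by (metis mat_adjoint_adjoint)
qed

lemma unitarily_similar_imp_similar:
  assumes "unitarily_similar n A B"
  shows "similar_mat A B"
proof -
  obtain U where "B \<in> carrier_mat n n" "unitary_mat n U" "A = mat_adjoint U * B * U"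
    using assms by (auto simp: unitarily_similar_iff)
  then have "similar_mat_wit A B (mat_adjoint U) U"
    by (intro similar_mat_witI[of _ _ n])
      (auto dest: unitary_matD intro!: mult_carrier_mat[of _ n n])
  then show ?thesis by (auto simp: similar_mat_def)
qed

lemma numerical_range_mono_unitarily_similar:
  assumes "unitarily_similar n A B"
  shows "numerical_range A \<subseteq> numerical_range B"
proof
  obtain U where B: "B \<in> carrier_mat n n" and U: "unitary_mat n U" and A: "A = mat_adjoint U * B * U"
    using assms by (auto simp: unitarily_similar_iff)
  note Uc = unitary_matD(1)[OF U]
  fix z assume "z \<in> numerical_range A"
  moreover have "dim_row A = n" using Uc by (simp add: A)
  ultimately obtain x where x: "x \<in> carrier_vec n" "x \<bullet>c x = 1" and z: "z = (A *\<^sub>v x) \<bullet>c x"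
    by (auto simp: numerical_range_def)
  define y where "y = U *\<^sub>v x"
  have y: "y \<in> carrier_vec n" using Uc x by (simp add: y_def)
  have "A *\<^sub>v x = mat_adjoint U *\<^sub>v (B *\<^sub>v y)"
    using Uc B x by (simp add: A y_def assoc_mult_mat_vec[of _ n n _ n] mult_carrier_mat[of _ n n _ n])
  then have "z = (B *\<^sub>v y) \<bullet>c y"
    using cscalar_prod_adjoint[of "mat_adjoint U" n n "B *\<^sub>v y" x] Uc B y x by (simp add: z y_def)
  moreover have "y \<bullet>c y = 1"
  proof -
    have "y \<bullet>c y = x \<bullet>c (mat_adjoint U *\<^sub>v y)"
      using cscalar_prod_adjoint[of U n n x y] Uc x y by (simp add: y_def)
    also have "mat_adjoint U *\<^sub>v y = x"
      using Uc x unitary_matD(2)[OF U] by (simp add: y_def flip: assoc_mult_mat_vec[of _ n n _ n])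
    finally show ?thesis using x by simp
  qed
  ultimately show "z \<in> numerical_range B" using B y by (auto simp: numerical_range_def)
qed

lemma numerical_range_unitarily_similar:
  "unitarily_similar n A B \<Longrightarrow> numerical_range A = numerical_range B"
  by (meson numerical_range_mono_unitarily_similar unitarily_similar_sym subset_antisym)

section \<open>Zero compressions and the zero-dilation index\<close>

lemma zero_compression_unitarily_similar:
  assumes "unitarily_similar n A B" "zero_compression A k"
  shows "zero_compression B k"
proof -
  obtain U where B: "B \<in> carrier_mat n n" and U: "unitary_mat n U" and A: "A = mat_adjoint U * B * U"
    using assms by (auto simp: unitarily_similar_iff)
  note Uc = unitary_matD(1)[OF U]
  have "dim_row A = n" using Uc by (simp add: A)
  then obtain V where V: "V \<in> carrier_mat n k" "mat_adjoint V * V = 1\<^sub>m k"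
    "mat_adjoint V * A * V = 0\<^sub>m k k"
    using assms(2) by (auto simp: zero_compression_def)
  have "mat_adjoint (U * V) * B * (U * V) = 0\<^sub>m k k"
    using conjugation_assoc[of B n U V k] B Uc V by (simp add: A)
  moreover have "mat_adjoint (U * V) * (U * V) = 1\<^sub>m k"
  proof -
    \<comment> \<open>With the identity as middle matrix the rule for conjugations says that
      \<open>U * V\<close> is again an isometry.\<close>
    have "mat_adjoint (U * V) * 1\<^sub>m n * (U * V) = mat_adjoint V * (mat_adjoint U * 1\<^sub>m n * U) * V"
      by (rule conjugation_assoc) (use Uc V in auto)
    then show ?thesis using V Uc unitary_matD(2)[OF U] mult_carrier_mat[OF Uc V(1)] by simp
  qed
  ultimately show ?thesis using B Uc V unfolding zero_compression_def by (auto intro!: bexI[of _ "U * V"])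
qed

text \<open>If there were more columns than rows, padding \<open>V\<close> with zero rows would give
  a square isometry, hence a unitary matrix. Its row \<open>n\<close> would be zero, although rows
  of a unitary matrix have norm \<open>1\<close>.\<close>

lemma isometry_cols_le_rows:
  fixes V :: "complex mat"
  assumes V: "V \<in> carrier_mat n k" "mat_adjoint V * V = 1\<^sub>m k"
  shows "k \<le> n"
proof (rule ccontr)
  assume "\<not> k \<le> n"
  then have nk: "n < k" by simp
  define W where "W = mat k k (\<lambda>(i,j). if i < n then V $$ (i,j) else 0)"
  have W: "W \<in> carrier_mat k k" by (simp add: W_def)
  have "mat_adjoint W * W = mat_adjoint V * V"
  proof (rule eq_matI)
    fix i j assume ij: "i < dim_row (mat_adjoint V * V)" "j < dim_col (mat_adjoint V * V)"
    have "(mat_adjoint W * W) $$ (i,j) = (\<Sum>l\<in>{0..<k}. cnj (W $$ (l,i)) * W $$ (l,j))"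
      using ij V by (simp add: W_def scalar_prod_def)
    also have "\<dots> = (\<Sum>l\<in>{0..<n}. cnj (V $$ (l,i)) * V $$ (l,j))"
      by (rule sum.mono_neutral_cong_right) (use nk ij V in \<open>auto simp: W_def\<close>)
    also have "\<dots> = (mat_adjoint V * V) $$ (i,j)"
      using ij V(1) by (simp add: scalar_prod_def)
    finally show "(mat_adjoint W * W) $$ (i,j) = (mat_adjoint V * V) $$ (i,j)" .
  qed (use V in \<open>simp_all add: W_def\<close>)
  then have "unitary_mat k W" using W V by (intro unitary_matI) simp_all
  then have "(W * mat_adjoint W) $$ (n,n) = 1" using nk by (simp add: unitary_mat_def)
  moreover have "(W * mat_adjoint W) $$ (n,n) = 0"
    using nk by (simp add: W_def scalar_prod_def)
  ultimately show False by simp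
qed

lemma zero_compression_full:
  assumes "A \<in> carrier_mat n n" "zero_compression A n"
  shows "A = 0\<^sub>m n n"
proof -
  obtain V where V: "V \<in> carrier_mat n n" "mat_adjoint V * V = 1\<^sub>m n" "mat_adjoint V * A * V = 0\<^sub>m n n"
    using assms by (auto simp: zero_compression_def)
  have "A = V * (mat_adjoint V * A * V) * mat_adjoint V"
    by (rule unitary_conjugation_cancel[OF unitary_matI[OF V(1,2)] assms(1), symmetric])
  then show ?thesis using V by simp
qed

text \<open>Zero compressions have size at most \<open>n\<close>, and size \<open>n\<close> occurs
  only for the zero matrix. This replaces the maximum by the existence of one compression.\<close>

lemma zero_dilation_index_eq_pred_iff:
  assumes A: "A \<in> carrier_mat n n" and n: "n \<ge> 2"
  shows "zero_dilation_index A = n - 1 \<longleftrightarrow> zero_compression A (n - 1) \<and> A \<noteq> 0\<^sub>m n n"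
proof
  define P where "P = (\<lambda>k. k \<ge> 1 \<and> zero_compression A k)"
  have idx: "zero_dilation_index A = (if \<exists>k. P k then Greatest P else 0)"
    by (auto simp: zero_dilation_index_def P_def)
  have le: "k \<le> n" if "P k" for k
    using that A isometry_cols_le_rows by (auto simp: P_def zero_compression_def)
  {
    assume d: "zero_dilation_index A = n - 1"
    \<comment> \<open>Because \<open>n \<ge> 2\<close>, the value \<open>n - 1\<close> is not the
      default \<open>0\<close> of a matrix without zero compressions.\<close>
    then have ex: "\<exists>k. P k" and G: "Greatest P = n - 1" using n idx by (auto split: if_splits)
    have "P (Greatest P)" using ex le by (metis GreatestI_ex_nat)
    then have "zero_compression A (n - 1)" unfolding G by (simp add: P_def)
    moreover have "A \<noteq> 0\<^sub>m n n"
    proof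
      assume "A = 0\<^sub>m n n"
      then have "P n" using n by (auto simp: P_def zero_compression_def intro!: bexI[of _ "1\<^sub>m n"])
      then have "n \<le> Greatest P" using le by (metis Greatest_le_nat)
      then show False using G n by simp
    qed
    ultimately show "zero_compression A (n - 1) \<and> A \<noteq> 0\<^sub>m n n" by blast
  next
    assume *: "zero_compression A (n - 1) \<and> A \<noteq> 0\<^sub>m n n"
    then have P: "P (n - 1)" using n by (simp add: P_def)
    have "k \<le> n - 1" if "P k" for k
      using le[OF that] that zero_compression_full[OF A] * by (cases "k = n") (auto simp: P_def)
    then have "Greatest P = n - 1" using P by (intro Greatest_equality)
    then show "zero_dilation_index A = n - 1" using P by (auto simp: idx)
  }
qed

text \<open>The isometry \<open>V\<close> is extended by the identity on the zero summand.\<close>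

lemma zero_compression_direct_sum_zero:
  assumes B: "B \<in> carrier_mat n n" and "zero_compression B k"
  shows "zero_compression (diag_block_mat [B, 0\<^sub>m m m]) (k + m)"
proof -
  obtain V where V: "V \<in> carrier_mat n k" "mat_adjoint V * V = 1\<^sub>m k" "mat_adjoint V * B * V = 0\<^sub>m k k"
    using assms by (auto simp: zero_compression_def)
  define D where "D = four_block_mat B (0\<^sub>m n m) (0\<^sub>m m n) (0\<^sub>m m m)"
  define W where "W = four_block_mat V (0\<^sub>m n m) (0\<^sub>m m k) (1\<^sub>m m)"
  have D: "diag_block_mat [B, 0\<^sub>m m m] = D"
    using B by (simp add: D_def Let_def)
  have Wc: "W \<in> carrier_mat (n + m) (k + m)" using V by (simp add: W_def)
  have adjW: "mat_adjoint W = four_block_mat (mat_adjoint V) (0\<^sub>m k m) (0\<^sub>m m n) (1\<^sub>m m)"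
  proof -
    have "mat_adjoint (0\<^sub>m a b :: complex mat) = 0\<^sub>m b a" for a b by (rule eq_matI) simp_all
    then show ?thesis using V by (simp add: W_def mat_adjoint_four_block[of _ n k _ m _ m])
  qed
  have "mat_adjoint W * W = four_block_mat (1\<^sub>m k) (0\<^sub>m k m) (0\<^sub>m m k) (1\<^sub>m m)"
    unfolding adjW unfolding W_def using V
    by (subst mult_four_block_mat[of _ k n _ m _ m _ _ k _ m]) simp_all
  then have "mat_adjoint W * W = 1\<^sub>m (k + m)" by simp
  moreover have "mat_adjoint W * D = four_block_mat (mat_adjoint V * B) (0\<^sub>m k m) (0\<^sub>m m n) (0\<^sub>m m m)"
    unfolding adjW D_def using V B
    by (subst mult_four_block_mat[of _ k n _ m _ m _ _ n _ m])
      (simp_all add: right_add_zero_mat[OF mult_carrier_mat[of _ k n _ n]])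
  then have "mat_adjoint W * D * W = 0\<^sub>m (k + m) (k + m)"
    unfolding W_def using V B mult_carrier_mat[of "mat_adjoint V" k n B n]
    by (simp, subst mult_four_block_mat[of _ k n _ m _ m _ _ k _ m]) simp_all
  moreover have "dim_row D = n + m" using B by (simp add: D_def)
  ultimately show ?thesis unfolding D zero_compression_def using Wc by auto
qed

section \<open>Householder reflections and triangularization\<close>

text \<open>\<open>Q\<close> is the reflection along a vector \<open>w\<close> that agrees with
  \<open>u\<close> after position \<open>k\<close> and vanishes before it. As the first
  \<open>k\<close> coordinates are left alone, reflections can be composed without spoiling earlier
  zeros.\<close>

lemma householder:
  fixes u :: "complex vec"
  assumes u: "u \<in> carrier_vec n" and k: "k < n"
  obtains Q where "unitary_mat n Q" "\<And>i. k < i \<Longrightarrow> i < n \<Longrightarrow> (Q *\<^sub>v u) $ i = 0"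
    "\<And>i j. i < n \<Longrightarrow> j < n \<Longrightarrow> i < k \<or> j < k \<Longrightarrow> Q $$ (i, j) = (if i = j then 1 else 0)"
proof -
  define t where "t = (\<Sum>l\<in>{k<..<n}. (norm (u $ l))\<^sup>2)"
  define \<sigma> where "\<sigma> = sqrt ((norm (u $ k))\<^sup>2 + t)"
  have t: "t \<ge> 0" by (simp add: t_def sum_nonneg)
  have split: "(\<Sum>l<n. f l) = f k + (\<Sum>l\<in>{k<..<n}. f l)" if "\<And>l. l < k \<Longrightarrow> f l = 0"
    for f :: "nat \<Rightarrow> complex"
  proof -
    have "(\<Sum>l<n. f l) = (\<Sum>l\<in>insert k {k<..<n}. f l)"
      by (rule sum.mono_neutral_right) (use k that linorder_neqE_nat in \<open>auto, blast\<close>)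
    then show ?thesis by simp
  qed
  show thesis
  proof (cases "\<sigma> = 0")
    case True
    then have "t = 0" using t by (simp add: \<sigma>_def add_nonneg_eq_0_iff)
    then have "u $ i = 0" if "k < i" "i < n" for i
      using that sum_nonneg_eq_0_iff[of "{k<..<n}" "\<lambda>l. (norm (u $ l))\<^sup>2"] by (simp add: t_def)
    then show ?thesis using that[of "1\<^sub>m n"] unitary_mat_one u by auto
  next
    case False
    then have \<sigma>: "\<sigma> > 0" using t by (simp add: \<sigma>_def less_le)
    have \<sigma>2: "\<sigma>\<^sup>2 = (norm (u $ k))\<^sup>2 + t" using t by (simp add: \<sigma>_def)
    obtain v where v: "norm v = 1" "v * u $ k = of_real (norm (u $ k))"
      by (rule unimodular_rotation)
    have vv: "cnj v * v = 1" using v(1) by (simp add: complex_norm_square[symmetric] mult.commute)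
    have uk: "u $ k = of_real (norm (u $ k)) * cnj v"
      using vv v(2) by (metis mult.assoc mult.commute mult_1)
    \<comment> \<open>\<open>cnj v\<close> carries the phase of \<open>u $ k\<close>, so adding
      \<open>\<sigma>\<close> causes no cancellation and \<open>w\<close> is nonzero.
      \<open>S\<close> is the squared norm of \<open>w\<close>, and \<open>u\<close> has inner
      product \<open>S / 2\<close> with \<open>w\<close>; therefore \<open>Q\<close> maps
      \<open>u\<close> to \<open>u - w\<close>.\<close>
    define w where "w = (\<lambda>i. if i < k then 0 else if i = k then of_real (norm (u $ k) + \<sigma>) * cnj v else u $ i)"
    define S where "S = 2 * (\<sigma>\<^sup>2 + \<sigma> * norm (u $ k))"
    have S: "S > 0" using \<sigma> by (simp add: S_def add_pos_nonneg)
    have tt: "(\<Sum>l\<in>{k<..<n}. u $ l * cnj (w l)) = of_real t" "(\<Sum>l\<in>{k<..<n}. w l * cnj (w l)) = of_real t"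
      by (simp_all add: t_def w_def complex_norm_square[symmetric])
    have ww: "(\<Sum>l<n. w l * cnj (w l)) = of_real S"
    proof -
      have "(\<Sum>l<n. w l * cnj (w l)) = of_real ((norm (u $ k) + \<sigma>)\<^sup>2) * (cnj v * v) + of_real t"
        by (subst split) (simp_all add: tt, simp_all add: w_def power2_eq_square)
      also have "\<dots> = of_real ((norm (u $ k) + \<sigma>)\<^sup>2 + t)" by (simp add: vv)
      also have "(norm (u $ k) + \<sigma>)\<^sup>2 + t = S"
        using \<sigma>2 by (simp add: S_def power2_sum)
      finally show ?thesis .
    qed
    have uw: "(\<Sum>l<n. u $ l * cnj (w l)) = of_real (S / 2)"
    proof -
      have "(\<Sum>l<n. u $ l * cnj (w l)) =
          of_real (norm (u $ k) * (norm (u $ k) + \<sigma>)) * (cnj v * v) + of_real t"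
        by (subst split) (simp_all add: tt, simp_all add: w_def, subst uk, simp)
      also have "\<dots> = of_real (norm (u $ k) * (norm (u $ k) + \<sigma>) + t)" by (simp add: vv)
      also have "norm (u $ k) * (norm (u $ k) + \<sigma>) + t = S / 2"
        using \<sigma>2 by (simp add: S_def power2_eq_square algebra_simps)
      finally show ?thesis .
    qed
    define Q where "Q = mat n n (\<lambda>(i,j). (if i = j then 1 else 0) - of_real (2 / S) * w i * cnj (w j))"
    have Q: "Q \<in> carrier_mat n n" by (simp add: Q_def)
    have "mat_adjoint Q * Q = 1\<^sub>m n"
    proof (rule eq_matI)
      fix i j assume "i < dim_row (1\<^sub>m n)" "j < dim_col (1\<^sub>m n)"
      then have ij: "i < n" "j < n" by simp_all
      define \<tau> where "\<tau> = complex_of_real (2 / S)"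
      have "(mat_adjoint Q * Q) $$ (i,j) =
          (\<Sum>l<n. ((if l = i then 1 else 0) - \<tau> * cnj (w l) * w i) * ((if l = j then 1 else 0) - \<tau> * w l * cnj (w j)))"
        using ij by (auto simp: Q_def \<tau>_def scalar_prod_def atLeast0LessThan intro!: sum.cong)
      also have "\<dots> = (\<Sum>l<n. (if l = i then (if i = j then 1 else 0) - \<tau> * w i * cnj (w j) else 0)
          - (if l = j then \<tau> * cnj (w j) * w i else 0) + \<tau> * w i * cnj (w j) * \<tau> * (w l * cnj (w l)))"
        by (rule sum.cong) (auto simp: algebra_simps)
      also have "\<dots> = (if i = j then 1 else 0) - \<tau> * w i * cnj (w j) - \<tau> * cnj (w j) * w i
          + \<tau> * w i * cnj (w j) * \<tau> * of_real S"
        using ij by (simp add: sum.distrib sum_subtractf ww flip: sum_distrib_left)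
      also have "\<dots> = (if i = j then 1 else 0) + \<tau> * w i * cnj (w j) * (\<tau> * of_real S - 2)"
        by (simp add: algebra_simps)
      also have "\<tau> * of_real S = 2" using S by (simp add: \<tau>_def)
      finally show "(mat_adjoint Q * Q) $$ (i,j) = 1\<^sub>m n $$ (i,j)" using ij by simp
    qed (use Q in simp_all)
    then have "unitary_mat n Q" by (rule unitary_matI[OF Q])
    moreover have "(Q *\<^sub>v u) $ i = 0" if "k < i" "i < n" for i
    proof -
      have "(Q *\<^sub>v u) $ i = (\<Sum>l<n. (if l = i then u $ i else 0) - of_real (2 / S) * w i * (u $ l * cnj (w l)))"
        using that u by (auto simp: Q_def scalar_prod_def atLeast0LessThan algebra_simps intro!: sum.cong)
      also have "\<dots> = u $ i - of_real (2 / S) * w i * of_real (S / 2)"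
        using that by (simp only: sum_subtractf sum_distrib_left[symmetric] uw) simp
      also have "\<dots> = u $ i - w i" using S by simp
      finally show ?thesis using that by (simp add: w_def)
    qed
    moreover have "Q $$ (i, j) = (if i = j then 1 else 0)" if "i < n" "j < n" "i < k \<or> j < k" for i j
      using that by (auto simp: Q_def w_def)
    ultimately show ?thesis using that by blast
  qed
qed

lemma unitary_mult_vec_nonzero:
  assumes U: "unitary_mat n U" and v: "v \<in> carrier_vec n" "v \<noteq> 0\<^sub>v n"
  shows "U *\<^sub>v v \<noteq> 0\<^sub>v n"
proof
  assume "U *\<^sub>v v = 0\<^sub>v n"
  then have "mat_adjoint U *\<^sub>v (U *\<^sub>v v) = 0\<^sub>v n"
    using unitary_matD(1)[OF U] by (auto intro!: eq_vecI simp: scalar_prod_def)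
  moreover have "mat_adjoint U *\<^sub>v (U *\<^sub>v v) = v"
    using unitary_matD[OF U] v by (simp flip: assoc_mult_mat_vec[of _ n n _ n])
  ultimately show False using v by simp
qed

text \<open>A reflection carries \<open>v\<close> to a multiple of the first basis vector, which
  becomes an eigenvector of the conjugated matrix and thereby determines its first column.\<close>

lemma eigenvector_deflation:
  assumes A: "A \<in> carrier_mat n n" and ev: "eigenvector A v e"
  obtains T where "unitarily_similar n A T"
    "\<And>i. i < n \<Longrightarrow> T $$ (i, 0) = (if i = 0 then e else 0)"
proof -
  have v: "v \<in> carrier_vec n" "v \<noteq> 0\<^sub>v n" "A *\<^sub>v v = e \<cdot>\<^sub>v v"
    using ev A by (auto simp: eigenvector_def)
  have n: "0 < n"
    using v by (metis gr0I zero_carrier_vec carrier_vecD eq_vecI less_nat_zero_code)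
  obtain Q where Q: "unitary_mat n Q" and Qv: "\<And>i. 0 < i \<Longrightarrow> i < n \<Longrightarrow> (Q *\<^sub>v v) $ i = 0"
    using householder[OF v(1) n] by metis
  note Qc = unitary_matD[OF Q]
  define \<beta> where "\<beta> = (Q *\<^sub>v v) $ 0"
  have Qv': "Q *\<^sub>v v = \<beta> \<cdot>\<^sub>v unit_vec n 0"
    using Qv Qc(1) v(1) by (intro eq_vecI) (auto simp: \<beta>_def unit_vec_def)
  have \<beta>: "\<beta> \<noteq> 0"
    using unitary_mult_vec_nonzero[OF Q v(1,2)] Qv' by auto
  define T where "T = Q * A * mat_adjoint Q"
  have T: "T \<in> carrier_mat n n" using A Qc by (auto simp: T_def)
  have QQ: "mat_adjoint Q *\<^sub>v (Q *\<^sub>v v) = v"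
    using Qc v by (simp flip: assoc_mult_mat_vec[of _ n n _ n])
  have "T *\<^sub>v (Q *\<^sub>v v) = Q *\<^sub>v (A *\<^sub>v (mat_adjoint Q *\<^sub>v (Q *\<^sub>v v)))"
    using Qc(1) A v(1) mult_mat_vec_carrier[of "mat_adjoint Q" n n "Q *\<^sub>v v"]
    by (simp add: T_def assoc_mult_mat_vec[of _ n n _ n] mult_carrier_mat[of _ n n _ n])
  also have "\<dots> = e \<cdot>\<^sub>v (Q *\<^sub>v v)"
    unfolding QQ v(3) using Qc(1) v(1) by (simp add: mult_mat_vec)
  finally have eq: "T *\<^sub>v (\<beta> \<cdot>\<^sub>v unit_vec n 0) = e \<cdot>\<^sub>v (\<beta> \<cdot>\<^sub>v unit_vec n 0)"
    by (simp add: Qv')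
  have "T $$ (i, 0) = (if i = 0 then e else 0)" if "i < n" for i
  proof -
    have "(T *\<^sub>v (\<beta> \<cdot>\<^sub>v unit_vec n 0)) $ i = \<beta> * T $$ (i, 0)"
      using T that n by (simp add: scalar_prod_def unit_vec_def if_distrib cong: if_cong)
    then show ?thesis using eq \<beta> that n by (auto simp: unit_vec_def)
  qed
  moreover have "unitarily_similar n A T"
    unfolding T_def by (rule unitarily_similar_conjugate[OF A Q])
  ultimately show ?thesis using that by blast
qed

text \<open>Schur's induction: one eigenvector is split off, and the unitary matrix that
  triangularizes the remaining block \<open>A'\<close> is bordered by a \<open>1\<close>.\<close>

lemma unitary_triangularization:
  assumes "A \<in> carrier_mat n n"
  shows "\<exists>T. unitarily_similar n A T \<and> upper_triangular T"
  using assms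
proof (induction n arbitrary: A)
  case 0
  then show ?case
    by (intro exI[of _ A]) (auto simp: unitarily_similar_iff intro!: exI[of _ "1\<^sub>m 0"] unitary_mat_one)
next
  case (Suc n)
  obtain as where "char_poly A = (\<Prod>a\<leftarrow>as. [:- a, 1:])" "length as = Suc n"
    using char_poly_factorized[OF Suc.prems] by blast
  then have "poly (char_poly A) (hd as) = 0" by (cases as) auto
  then obtain v where "eigenvector A v (hd as)"
    using eigenvalue_root_char_poly[OF Suc.prems] by (auto simp: eigenvalue_def)
  then obtain T where T: "unitarily_similar (Suc n) A T"
    and T0: "\<And>i. i < Suc n \<Longrightarrow> T $$ (i, 0) = (if i = 0 then hd as else 0)"
    by (rule eigenvector_deflation[OF Suc.prems]) blast
  have Tc: "T \<in> carrier_mat (Suc n) (Suc n)" using T by (simp add: unitarily_similar_def)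
  define A' where "A' = mat n n (\<lambda>(i,j). T $$ (Suc i, Suc j))"
  define R where "R = mat 1 n (\<lambda>(i,j). T $$ (0, Suc j))"
  define E where "E = mat 1 1 (\<lambda>_. T $$ (0,0))"
  have car: "A' \<in> carrier_mat n n" "R \<in> carrier_mat 1 n" "E \<in> carrier_mat 1 1"
    by (simp_all add: A'_def R_def E_def)
  have Tb: "T = four_block_mat E R (0\<^sub>m n 1) A'"
    using Tc T0 by (intro eq_matI) (auto simp: A'_def R_def E_def)
  obtain T' where "unitarily_similar n A' T'" "upper_triangular T'"
    using Suc.IH[OF car(1)] by blast
  then obtain U where T': "T' \<in> carrier_mat n n" "upper_triangular T'"
    and U: "unitary_mat n U" and A': "A' = mat_adjoint U * T' * U"
    by (auto simp: unitarily_similar_iff)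
  note Uc = unitary_matD[OF U]
  define W where "W = four_block_mat (1\<^sub>m 1) (0\<^sub>m 1 n) (0\<^sub>m n 1) U"
  have z: "mat_adjoint (0\<^sub>m a b :: complex mat) = 0\<^sub>m b a" for a b by (rule eq_matI) simp_all
  have Wc: "W \<in> carrier_mat (Suc n) (Suc n)" using Uc by (auto simp: W_def)
  have adjW: "mat_adjoint W = four_block_mat (1\<^sub>m 1) (0\<^sub>m 1 n) (0\<^sub>m n 1) (mat_adjoint U)"
    unfolding W_def using Uc by (subst mat_adjoint_four_block[of _ 1 1 _ n _ n]) (simp_all add: z)
  have "mat_adjoint W * W = four_block_mat (1\<^sub>m 1) (0\<^sub>m 1 n) (0\<^sub>m n 1) (1\<^sub>m n)"
    unfolding adjW unfolding W_def using Uc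
    by (subst mult_four_block_mat[of _ 1 1 _ n _ n _ _ 1 _ n]) simp_all
  then have W: "unitary_mat (Suc n) W" using Wc by (intro unitary_matI) simp_all
  have "U * A' * mat_adjoint U = T'"
    unfolding A' by (rule unitary_conjugation_cancel[OF U T'(1)])
  have UA: "U * A' \<in> carrier_mat n n" using Uc car by simp
  have "W * T = four_block_mat E R (0\<^sub>m n 1) (U * A')"
    unfolding Tb W_def using Uc car UA
    by (subst mult_four_block_mat[of _ 1 1 _ n _ n _ _ 1 _ n]) simp_all
  then have "W * T * mat_adjoint W = four_block_mat E (R * mat_adjoint U) (0\<^sub>m n 1) T'"
    unfolding adjW using Uc car UA \<open>U * A' * mat_adjoint U = T'\<close> mult_carrier_mat[OF car(2), of "mat_adjoint U" n] T'(1)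
    by (simp, subst mult_four_block_mat[of _ 1 1 _ n _ n _ _ 1 _ n]) simp_all
  moreover have "upper_triangular (four_block_mat E (R * mat_adjoint U) (0\<^sub>m n 1) T')"
    by (rule upper_triangular_four_block[of _ 1 _ n]) (use car T' in auto)
  moreover have "unitarily_similar (Suc n) A (W * T * mat_adjoint W)"
    using unitarily_similar_trans[OF T unitarily_similar_conjugate[OF Tc W]] .
  ultimately show ?case by metis
qed

section \<open>Symmetric numerical ranges of 3 by 3 matrices\<close>

lemma det_2:
  fixes A :: "'a :: comm_ring_1 mat"
  assumes "A \<in> carrier_mat 2 2"
  shows "det A = A $$ (0,0) * A $$ (1,1) - A $$ (0,1) * A $$ (1,0)"
  using laplace_expansion_row[OF assms, of 0] assms
  by (simp add: cofactor_def mat_delete_def det_single numeral_2_eq_2)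

lemma det_3:
  fixes A :: "'a :: comm_ring_1 mat"
  assumes "A \<in> carrier_mat 3 3"
  shows "det A = A $$ (0,0) * (A $$ (1,1) * A $$ (2,2) - A $$ (1,2) * A $$ (2,1))
    - A $$ (0,1) * (A $$ (1,0) * A $$ (2,2) - A $$ (1,2) * A $$ (2,0))
    + A $$ (0,2) * (A $$ (1,0) * A $$ (2,1) - A $$ (1,1) * A $$ (2,0))"
  using laplace_expansion_row[OF assms, of 0] assms
  by (simp add: cofactor_def mat_delete_def det_2 numeral_3_eq_3 numeral_2_eq_2 algebra_simps)

lemma char_poly_3:
  fixes A :: "complex mat"
  assumes "A \<in> carrier_mat 3 3"
  shows "char_poly A = [:- det A,
    A $$ (0,0) * A $$ (1,1) - A $$ (0,1) * A $$ (1,0) + A $$ (0,0) * A $$ (2,2) - A $$ (0,2) * A $$ (2,0)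
      + A $$ (1,1) * A $$ (2,2) - A $$ (1,2) * A $$ (2,1),
    - (A $$ (0,0) + A $$ (1,1) + A $$ (2,2)), 1:]"
proof -
  have "char_poly_matrix A \<in> carrier_mat 3 3" using assms by simp
  then show ?thesis
    unfolding char_poly_def det_3[OF assms] using assms
    by (simp add: det_3 char_poly_matrix_def algebra_simps)
qed

definition trace3 :: "complex mat \<Rightarrow> complex" where
  "trace3 A = A $$ (0,0) + A $$ (1,1) + A $$ (2,2)"

lemma
  assumes "unitarily_similar 3 A B"
  shows trace3_unitarily_similar: "trace3 A = trace3 B"
    and det_unitarily_similar: "det A = det B"
proof -
  have "A \<in> carrier_mat 3 3" "B \<in> carrier_mat 3 3"
    using assms by (auto simp: unitarily_similar_def)
  moreover have *: "char_poly A = char_poly B"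
    by (rule char_poly_similar[OF unitarily_similar_imp_similar[OF assms]])
  ultimately show "det A = det B" by (simp add: char_poly_3)
  have "trace3 C = - coeff (char_poly C) 2" if "C \<in> carrier_mat 3 3" for C
    using that by (simp add: trace3_def char_poly_3 numeral_2_eq_2)
  then show "trace3 A = trace3 B" using * assms by (simp add: unitarily_similar_def)
qed

lemma sum_3: "(\<Sum>i\<in>{0..<3}. f i) = f 0 + f 1 + f (2::nat)"
  by (simp add: numeral_3_eq_3 numeral_2_eq_2)

lemma cscalar_prod_3:
  fixes x y :: "complex vec"
  assumes "x \<in> carrier_vec 3" "y \<in> carrier_vec 3"
  shows "x \<bullet>c y = x $ 0 * cnj (y $ 0) + x $ 1 * cnj (y $ 1) + x $ 2 * cnj (y $ 2)"
  using assms by (simp add: scalar_prod_def sum_3)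

lemma mult_mat_vec_3:
  fixes A :: "complex mat"
  assumes "A \<in> carrier_mat 3 3" "x \<in> carrier_vec 3" "i < 3"
  shows "(A *\<^sub>v x) $ i = A $$ (i,0) * x $ 0 + A $$ (i,1) * x $ 1 + A $$ (i,2) * x $ 2"
  using assms by (simp add: scalar_prod_def sum_3)

lemma hermitian_form_3:
  fixes A :: "complex mat"
  assumes "A \<in> carrier_mat 3 3" "x \<in> carrier_vec 3" "y \<in> carrier_vec 3"
  shows "(A *\<^sub>v x) \<bullet>c y =
    (A $$ (0,0) * x $ 0 + A $$ (0,1) * x $ 1 + A $$ (0,2) * x $ 2) * cnj (y $ 0)
    + (A $$ (1,0) * x $ 0 + A $$ (1,1) * x $ 1 + A $$ (1,2) * x $ 2) * cnj (y $ 1)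
    + (A $$ (2,0) * x $ 0 + A $$ (2,1) * x $ 1 + A $$ (2,2) * x $ 2) * cnj (y $ 2)"
  using assms mult_mat_vec_3[OF assms(1,2)] by (subst cscalar_prod_3) auto

lemma unit_vec_3:
  fixes x :: "complex vec"
  assumes "x \<in> carrier_vec 3"
  shows "x \<bullet>c x = 1 \<longleftrightarrow> (norm (x $ 0))\<^sup>2 + (norm (x $ 1))\<^sup>2 + (norm (x $ 2))\<^sup>2 = 1"
proof -
  have "x \<bullet>c x = of_real ((norm (x $ 0))\<^sup>2 + (norm (x $ 1))\<^sup>2 + (norm (x $ 2))\<^sup>2)"
    using assms by (simp add: cscalar_prod_3 complex_norm_square[symmetric])
  then show ?thesis by (metis of_real_eq_1_iff)
qed

text \<open>The hypothesis says that the numerical range, an interval \<open>[l, u]\<close> with \<open>l\<close> and \<open>u\<close> the extreme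
  eigenvalues, is symmetric about half the trace; hence the trace is \<open>l + u\<close> and the
  remaining eigenvalue vanishes.\<close>

lemma hermitian_symmetric_range_singular:
  assumes H: "H \<in> carrier_mat 3 3" "mat_adjoint H = H"
    and sym: "\<And>z. z \<in> numerical_range H \<Longrightarrow> trace3 H - z \<in> numerical_range H"
  shows "det H = 0"
proof -
  obtain T where T: "unitarily_similar 3 H T" and ut: "upper_triangular T"
    using unitary_triangularization[OF H(1)] by blast
  have Tc: "T \<in> carrier_mat 3 3" using T by (simp add: unitarily_similar_def)
  have Th: "mat_adjoint T = T"
  proof -
    obtain U where U: "unitary_mat 3 U" and TU: "T = mat_adjoint U * H * U"
      using unitarily_similar_sym[OF T] by (auto simp: unitarily_similar_iff)
    note Uc = unitary_matD(1)[OF U]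
    show ?thesis unfolding TU using Uc H
      by (simp add: mat_adjoint_mult[of _ 3 3 _ 3] mult_carrier_mat[of _ 3 3 _ 3]
          assoc_mult_mat[of _ 3 3 _ 3 _ 3])
  qed
  have T_cnj: "T $$ (i,j) = cnj (T $$ (j,i))" if "i < 3" "j < 3" for i j
    using index_mat_adjoint[of i T j] Th that Tc by simp
  have low: "T $$ (i,j) = 0" if "j < i" "i < 3" for i j
    using upper_triangularD[OF ut] that Tc by simp
  \<comment> \<open>A matrix that is both triangular and Hermitian is diagonal.\<close>
  have off: "T $$ (1,0) = 0" "T $$ (2,0) = 0" "T $$ (2,1) = 0"
    "T $$ (0,1) = 0" "T $$ (0,2) = 0" "T $$ (1,2) = 0"
    using low[of 0 1] low[of 0 2] low[of 1 2] T_cnj[of 0 1] T_cnj[of 0 2] T_cnj[of 1 2] by simp_all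
  define l where "l = (\<lambda>i. Re (T $$ (i,i)))"
  have diag: "T $$ (i,i) = of_real (l i)" if "i < 3" for i
    using T_cnj[of i i] that by (simp add: l_def complex_eq_iff)
  define M where "M = max (l 0) (max (l 1) (l 2))"
  define m where "m = min (l 0) (min (l 1) (l 2))"
  \<comment> \<open>The values of a diagonal form at unit vectors are convex combinations of the
    diagonal entries, with weights \<open>p\<close>.\<close>
  have W: "m \<le> Re z \<and> Re z \<le> M" if zW: "z \<in> numerical_range T" for z
  proof -
    obtain x where x: "x \<in> carrier_vec 3" "x \<bullet>c x = 1" and z: "z = (T *\<^sub>v x) \<bullet>c x"
      using zW Tc by (auto simp: numerical_range_def)
    define p where "p = (\<lambda>i. (norm (x $ i))\<^sup>2)"
    have p: "p 0 + p 1 + p 2 = 1" "p 0 \<ge> 0" "p 1 \<ge> 0" "p 2 \<ge> 0"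
      using x unit_vec_3 by (auto simp: p_def)
    have "z = of_real (l 0 * p 0 + l 1 * p 1 + l 2 * p 2)"
      using x Tc unfolding z
      by (subst hermitian_form_3) (simp_all add: off[simplified] diag p_def mult.assoc complex_norm_square[symmetric])
    then have z': "Re z = l 0 * p 0 + l 1 * p 1 + l 2 * p 2" by simp
    have "m * (p 0 + p 1 + p 2) \<le> Re z"
      unfolding z' distrib_left by (intro add_mono mult_right_mono) (auto simp: m_def p[simplified])
    moreover have "Re z \<le> M * (p 0 + p 1 + p 2)"
      unfolding z' distrib_left by (intro add_mono mult_right_mono) (auto simp: M_def p[simplified])
    ultimately show ?thesis using p by simp
  qed
  have in_W: "of_real (l i) \<in> numerical_range T" if "i < 3" for i
  proof -
    have "(T *\<^sub>v unit_vec 3 i) \<bullet>c unit_vec 3 i = of_real (l i)"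
      using that Tc by (subst hermitian_form_3)
        (auto simp: unit_vec_def off[simplified] diag less_Suc_eq numeral_3_eq_3 numeral_2_eq_2)
    moreover have "(unit_vec 3 i :: complex vec) \<bullet>c unit_vec 3 i = 1"
      using that by (subst unit_vec_3) (auto simp: unit_vec_def less_Suc_eq numeral_3_eq_3 numeral_2_eq_2)
    ultimately show ?thesis using Tc by (force simp: numerical_range_def)
  qed
  have tr: "trace3 H = of_real (l 0 + l 1 + l 2)"
    using trace3_unitarily_similar[OF T] by (simp add: trace3_def diag)
  have bounds: "m \<le> l 0 + l 1 + l 2 - l i \<and> l 0 + l 1 + l 2 - l i \<le> M" if "i < 3" for i
  proof -
    have "trace3 H - of_real (l i) \<in> numerical_range T"
      using sym in_W[OF that] numerical_range_unitarily_similar[OF T] by simp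
    from W[OF this] show ?thesis by (simp add: tr)
  qed
  \<comment> \<open>For the index of the largest \<open>l i\<close> the lower bound makes the middle
    value at least \<open>0\<close>; for that of the smallest the upper bound makes it at most
    \<open>0\<close>.\<close>
  have "l 0 = 0 \<or> l 1 = 0 \<or> l 2 = 0"
    using bounds[of 0] bounds[of 1] bounds[of 2] unfolding M_def m_def max_def min_def
    by (auto split: if_splits)
  then have "det T = 0" using Tc by (auto simp: det_3 off[simplified] diag)
  then show ?thesis using det_unitarily_similar[OF T] by simp
qed

text \<open>The form of \<open>B + mat_adjoint B\<close> is twice the real part of the form of
  \<open>B\<close>, so its range is a scaled projection of that of \<open>B\<close> and inherits the
  symmetry about half the trace.\<close>

lemma symmetric_range_real_part_singular:
  assumes B: "B \<in> carrier_mat 3 3"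
    and sym: "\<And>z. z \<in> numerical_range B \<Longrightarrow> trace3 B - z \<in> numerical_range B"
  shows "det (B + mat_adjoint B) = 0"
proof (rule hermitian_symmetric_range_singular)
  let ?H = "B + mat_adjoint B"
  show H: "?H \<in> carrier_mat 3 3" using B by simp
  show "mat_adjoint ?H = ?H" using B by (intro eq_matI) auto
  have tr: "trace3 ?H = of_real (2 * Re (trace3 B))"
    using B by (simp add: trace3_def complex_eq_iff)
  have form: "(?H *\<^sub>v x) \<bullet>c x = of_real (2 * Re ((B *\<^sub>v x) \<bullet>c x))" if "x \<in> carrier_vec 3" for x
    unfolding hermitian_form_3[OF H that that] hermitian_form_3[OF B that that]
    using that B by (simp add: complex_eq_iff algebra_simps)
  have W: "numerical_range ?H = (\<lambda>z. of_real (2 * Re z)) ` numerical_range B"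
    using B H by (auto simp: numerical_range_def form) (rule_tac x = xb in exI, simp add: form)
  fix z assume "z \<in> numerical_range ?H"
  then obtain w where w: "w \<in> numerical_range B" "z = of_real (2 * Re w)" by (auto simp: W)
  then show "trace3 ?H - z \<in> numerical_range ?H"
    using sym[OF w(1)] by (auto simp: W tr algebra_simps intro!: image_eqI[of _ _ "trace3 B - w"])
qed

section \<open>Two-dimensional zero compressions\<close>

lemma index_compression:
  fixes A V :: "complex mat"
  assumes "A \<in> carrier_mat n n" "V \<in> carrier_mat n k" "i < k" "j < k"
  shows "(mat_adjoint V * A * V) $$ (i,j) = (A *\<^sub>v col V j) \<bullet>c col V i"
proof -
  have "(mat_adjoint V * A * V) $$ (i,j) = (mat_adjoint V * (A * V)) $$ (i,j)"
    using assms by (simp add: assoc_mult_mat[of _ k n _ n _ k])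
  also have "\<dots> = row (mat_adjoint V) i \<bullet> col (A * V) j" using assms by simp
  also have "row (mat_adjoint V) i = conjugate (col V i)"
    using assms by (intro eq_vecI) auto
  also have "col (A * V) j = A *\<^sub>v col V j" using assms by (intro eq_vecI) auto
  also have "conjugate (col V i) \<bullet> (A *\<^sub>v col V j) = (A *\<^sub>v col V j) \<bullet>c col V i"
    using assms by (intro comm_scalar_prod[of _ n]) auto
  finally show ?thesis .
qed

lemma zero_compression_2I:
  assumes A: "A \<in> carrier_mat n n" and xy: "x \<in> carrier_vec n" "y \<in> carrier_vec n"
    and orth: "x \<bullet>c x = 1" "y \<bullet>c y = 1" "x \<bullet>c y = 0" "y \<bullet>c x = 0"
    and zero: "(A *\<^sub>v x) \<bullet>c x = 0" "(A *\<^sub>v y) \<bullet>c y = 0" "(A *\<^sub>v x) \<bullet>c y = 0" "(A *\<^sub>v y) \<bullet>c x = 0"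
  shows "zero_compression A 2"
proof -
  define V where "V = mat_of_cols n [x, y]"
  have V: "V \<in> carrier_mat n 2" using mat_of_cols_carrier(1)[of n "[x, y]"] by (simp add: V_def numeral_2_eq_2)
  have cols: "col V 0 = x" "col V 1 = y" using xy by (simp_all add: V_def)
  have less_2: "i < 2 \<longleftrightarrow> i = 0 \<or> i = 1" for i :: nat by auto
  have "mat_adjoint V * A * V = 0\<^sub>m 2 2"
    by (rule eq_matI)
      (use V in \<open>auto simp: index_compression[OF A V] less_2 cols zero simp del: index_mult_mat(1) One_nat_def\<close>)
  moreover have "(mat_adjoint V * V) $$ (i,j) = col V j \<bullet>c col V i" if "i < 2" "j < 2" for i j
    using index_compression[OF one_carrier_mat V that] V that by simp
  then have "mat_adjoint V * V = 1\<^sub>m 2"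
    by (intro eq_matI) (use V in \<open>auto simp: less_2 cols orth simp del: index_mult_mat(1) One_nat_def\<close>)
  ultimately show ?thesis using A V by (auto simp: zero_compression_def)
qed

text \<open>The first basis vector is killed by \<open>T\<close>, so two of the four entries of the
  compression to its span with \<open>w\<close> vanish. The equations for \<open>y1\<close> and
  \<open>y2\<close> express the other two; they are homogeneous, so division by
  \<open>\<rho>\<close> only normalizes.\<close>

lemma isotropic_plane_through_kernel:
  assumes T: "T \<in> carrier_mat 3 3" and T0: "\<And>i. i < 3 \<Longrightarrow> T $$ (i,0) = 0"
    and y: "y1 \<noteq> 0 \<or> y2 \<noteq> 0" "T $$ (0,1) * y1 + T $$ (0,2) * y2 = 0"
      "T $$ (1,1) * (y1 * cnj y1) + T $$ (1,2) * (y2 * cnj y1)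
        + T $$ (2,1) * (y1 * cnj y2) + T $$ (2,2) * (y2 * cnj y2) = 0"
  shows "zero_compression T 2"
proof -
  define \<rho> where "\<rho> = sqrt ((norm y1)\<^sup>2 + (norm y2)\<^sup>2)"
  have \<rho>: "\<rho> > 0" using y(1) by (simp add: \<rho>_def sum_power2_gt_zero_iff)
  have \<rho>2: "\<rho> * \<rho> = (norm y1)\<^sup>2 + (norm y2)\<^sup>2" by (simp add: \<rho>_def)
  define x :: "complex vec" where "x = unit_vec 3 0"
  define w where "w = vec 3 (\<lambda>i. if i = 0 then 0 else if i = 1 then y1 / of_real \<rho> else y2 / of_real \<rho>)"
  have xw: "x \<in> carrier_vec 3" "w \<in> carrier_vec 3" by (simp_all add: x_def w_def)
  have xi: "x $ 0 = 1" "x $ 1 = 0" "x $ 2 = 0" by (simp_all add: x_def unit_vec_def)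
  have wi: "w $ 0 = 0" "w $ 1 = y1 / of_real \<rho>" "w $ 2 = y2 / of_real \<rho>" by (simp_all add: w_def)
  note comp = xi[simplified] wi[simplified] T0[of 0, simplified] T0[of 1, simplified] T0[of 2, simplified]
  show ?thesis
  proof (rule zero_compression_2I[OF T xw])
    show "x \<bullet>c x = 1" "x \<bullet>c w = 0" "w \<bullet>c x = 0" using xw by (simp_all add: cscalar_prod_3 comp)
    have "(norm (y1 / of_real \<rho>))\<^sup>2 + (norm (y2 / of_real \<rho>))\<^sup>2 = (\<rho> * \<rho>) / (\<rho> * \<rho>)"
      unfolding \<rho>2 using \<rho> by (simp add: norm_divide power_divide add_divide_distrib[symmetric] power2_eq_square \<rho>2)
    then show "w \<bullet>c w = 1" using \<rho> xw unit_vec_3[of w] by (simp add: comp)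
    show "(T *\<^sub>v x) \<bullet>c x = 0" "(T *\<^sub>v x) \<bullet>c w = 0"
      using T xw by (simp_all add: hermitian_form_3 comp)
    have "(T *\<^sub>v w) \<bullet>c x = (T $$ (0,1) * y1 + T $$ (0,2) * y2) / of_real \<rho>"
      using T xw by (simp add: hermitian_form_3 comp add_divide_distrib)
    then show "(T *\<^sub>v w) \<bullet>c x = 0" using y(2) by simp
    have "(T *\<^sub>v w) \<bullet>c w = (T $$ (1,1) * (y1 * cnj y1) + T $$ (1,2) * (y2 * cnj y1)
        + T $$ (2,1) * (y1 * cnj y2) + T $$ (2,2) * (y2 * cnj y2)) / (of_real \<rho> * of_real \<rho>)"
      using T xw by (simp add: hermitian_form_3 comp add_divide_distrib algebra_simps)
    then show "(T *\<^sub>v w) \<bullet>c w = 0" unfolding y(3) by simp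
  qed
qed

lemma numerical_range_smult:
  assumes "A \<in> carrier_mat n n"
  shows "numerical_range (k \<cdot>\<^sub>m A) = (\<lambda>z. k * z) ` numerical_range A"
proof -
  have form: "(k \<cdot>\<^sub>m A *\<^sub>v x) \<bullet>c x = k * ((A *\<^sub>v x) \<bullet>c x)" if "x \<in> carrier_vec n" for x
  proof -
    have "k \<cdot>\<^sub>m A *\<^sub>v x = k \<cdot>\<^sub>v (A *\<^sub>v x)" using assms that
      by (intro eq_vecI) (auto simp: scalar_prod_def sum_distrib_left mult.assoc)
    then show ?thesis using assms that by simp
  qed
  show ?thesis
    using assms by (auto simp: numerical_range_def form) (rule_tac x = xb in exI, simp add: form)
qed

text \<open>After deflation of a kernel vector the first row is \<open>(0, a, b)\<close>. If it is
  nonzero, the second spanning vector must be a multiple of \<open>(b, - a)\<close>, and two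
  singular Hermitian parts make that vector isotropic. If it is zero, the matrix splits, and
  \<open>binary_form_zero\<close> finds an isotropic vector of the lower block.\<close>

lemma symmetric_range_imp_zero_compression:
  assumes B: "B \<in> carrier_mat 3 3" and det: "det B = 0"
    and sym: "\<And>z. z \<in> numerical_range B \<Longrightarrow> trace3 B - z \<in> numerical_range B"
  shows "zero_compression B 2"
proof -
  have "poly (char_poly B) 0 = 0" using B det by (simp add: char_poly_3)
  then obtain v where "eigenvector B v 0"
    using eigenvalue_root_char_poly[OF B] by (auto simp: eigenvalue_def)
  then obtain T where T: "unitarily_similar 3 B T" and T0: "\<And>i. i < 3 \<Longrightarrow> T $$ (i,0) = 0"
    by (rule eigenvector_deflation[OF B]) auto
  have Tc: "T \<in> carrier_mat 3 3" using T by (simp add: unitarily_similar_def)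
  have symT: "trace3 T - z \<in> numerical_range T" if "z \<in> numerical_range T" for z
    using sym that numerical_range_unitarily_similar[OF T] trace3_unitarily_similar[OF T] by simp
  define a b where "a = T $$ (0,1)" and "b = T $$ (0,2)"
  define p d g q where "p = T $$ (1,1)" and "d = T $$ (1,2)" and "g = T $$ (2,1)" and "q = T $$ (2,2)"
  note abb = a_def b_def p_def d_def g_def q_def
  \<comment> \<open>Stated for general \<open>R\<close> because it is applied to \<open>T\<close>
    and to \<open>\<i>\<close> times \<open>T\<close>, yielding the real and the imaginary part of
    one equation.\<close>
  have Re0: "Re (R $$ (1,1) * (R $$ (0,2) * cnj (R $$ (0,2))) + R $$ (2,2) * (R $$ (0,1) * cnj (R $$ (0,1)))
      - R $$ (1,2) * R $$ (0,1) * cnj (R $$ (0,2)) - R $$ (2,1) * cnj (R $$ (0,1)) * R $$ (0,2)) = 0"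
    (is "Re ?\<phi> = 0")
    if R: "R \<in> carrier_mat 3 3" "\<And>i. i < 3 \<Longrightarrow> R $$ (i,0) = 0"
      "\<And>z. z \<in> numerical_range R \<Longrightarrow> trace3 R - z \<in> numerical_range R" for R
  proof -
    have "det (R + mat_adjoint R) = - (?\<phi> + cnj ?\<phi>)"
      using R(1) R(2)[of 0, simplified] R(2)[of 1, simplified] R(2)[of 2, simplified]
      by (simp add: det_3 algebra_simps)
    moreover have "det (R + mat_adjoint R) = 0"
      by (rule symmetric_range_real_part_singular[OF R(1) R(3)])
    ultimately have "?\<phi> + cnj ?\<phi> = 0" by (metis neg_equal_0_iff_equal)
    moreover have "Re z = 0" if "z + cnj z = 0" for z using that by (simp add: complex_eq_iff)
    ultimately show ?thesis by blast
  qed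
  \<comment> \<open>The value of the form of the lower block at \<open>(b, - a)\<close>, the vector
    annihilated by the first row.\<close>
  define \<phi> where "\<phi> = p * (b * cnj b) + q * (a * cnj a) - d * a * cnj b - g * cnj a * b"
  have "Re \<phi> = 0" unfolding \<phi>_def abb by (rule Re0[OF Tc T0 symT])
  moreover have "Re (\<i> * \<phi>) = 0"
  proof -
    have iT: "\<i> \<cdot>\<^sub>m T \<in> carrier_mat 3 3" "\<And>i. i < 3 \<Longrightarrow> (\<i> \<cdot>\<^sub>m T) $$ (i,0) = 0"
      using Tc T0 by auto
    have tr: "trace3 (\<i> \<cdot>\<^sub>m T) = \<i> * trace3 T"
      using Tc by (simp add: trace3_def algebra_simps)
    have "trace3 (\<i> \<cdot>\<^sub>m T) - z \<in> numerical_range (\<i> \<cdot>\<^sub>m T)" if "z \<in> numerical_range (\<i> \<cdot>\<^sub>m T)" for z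
      using that symT unfolding numerical_range_smult[OF Tc] tr
      by (auto simp: right_diff_distrib[symmetric])
    from Re0[OF iT this] have "Re (\<i> * (p * (b * cnj b) + q * (a * cnj a) - d * a * cnj b - g * cnj a * b)) = 0"
      using Tc unfolding abb by (simp add: algebra_simps)
    then show ?thesis by (simp add: \<phi>_def)
  qed
  ultimately have \<phi>: "\<phi> = 0" by (simp add: complex_eq_iff)
  have "zero_compression T 2"
  proof (cases "a = 0 \<and> b = 0")
    case False
    show ?thesis
    proof (rule isotropic_plane_through_kernel[OF Tc T0])
      show "b \<noteq> 0 \<or> - a \<noteq> 0" using False by auto
      show "T $$ (0,1) * b + T $$ (0,2) * - a = 0" by (simp add: abb)
      show "T $$ (1,1) * (b * cnj b) + T $$ (1,2) * (- a * cnj b) + T $$ (2,1) * (b * cnj (- a))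
          + T $$ (2,2) * (- a * cnj (- a)) = 0"
        using \<phi> unfolding \<phi>_def abb by (simp add: algebra_simps)
    qed
  next
    case True
    define Q where "Q = (\<lambda>w1 w2. p * (w1 * cnj w1) + d * (w2 * cnj w1) + g * (w1 * cnj w2) + q * (w2 * cnj w2))"
    have form: "(T *\<^sub>v x) \<bullet>c x = Q (x $ 1) (x $ 2)" if "x \<in> carrier_vec 3" for x
      using that Tc True T0[of 0, simplified] T0[of 1, simplified] T0[of 2, simplified]
      by (simp add: hermitian_form_3 Q_def abb algebra_simps)
    have tr: "trace3 T = p + q" using T0[of 0] by (simp add: trace3_def abb)
    have "\<exists>y1 y2. (y1 \<noteq> 0 \<or> y2 \<noteq> 0) \<and> Q y1 y2 = 0"
    proof (cases "p + q = 0")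
      case True
      \<comment> \<open>The values at the two basis vectors are opposite, which is the case
        \<open>\<kappa> = 1\<close>.\<close>
      then have "q = - p" by (simp add: add_eq_0_iff)
      then show ?thesis
        using binary_form_zero[of 1 0 p d g q p 1] by (simp add: Q_def)
    next
      case False
      \<comment> \<open>The kernel vector produces the value \<open>0\<close>, so by symmetry the
        trace \<open>p + q\<close> is a value as well.\<close>
      have "0 \<in> numerical_range T"
        using Tc form[of "unit_vec 3 0"] unfolding numerical_range_def
        by (auto simp: Q_def unit_vec_def cscalar_prod_3 intro!: exI[of _ "unit_vec 3 0"])
      then have "p + q \<in> numerical_range T" using symT[of 0] by (simp add: tr)
      then obtain x where x: "x \<in> carrier_vec 3" "x \<bullet>c x = 1" and pq: "Q (x $ 1) (x $ 2) = p + q"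
        using Tc form by (force simp: numerical_range_def)
      define \<kappa> where "\<kappa> = 1 - ((norm (x $ 1))\<^sup>2 + (norm (x $ 2))\<^sup>2)"
      have "\<kappa> = (norm (x $ 0))\<^sup>2" using x unit_vec_3[OF x(1)] by (simp add: \<kappa>_def)
      then have \<kappa>: "\<kappa> \<ge> 0" by simp
      have nz: "x $ 1 \<noteq> 0 \<or> x $ 2 \<noteq> 0" using pq False by (auto simp: Q_def)
      \<comment> \<open>The values at two orthogonal vectors of equal norm add up to the trace times
        their squared norm.\<close>
      have "Q (- cnj (x $ 2)) (cnj (x $ 1)) =
          (p + q) * (x $ 1 * cnj (x $ 1) + x $ 2 * cnj (x $ 2)) - Q (x $ 1) (x $ 2)"
        by (simp add: Q_def algebra_simps)
      also have "x $ 1 * cnj (x $ 1) + x $ 2 * cnj (x $ 2) = of_real (1 - \<kappa>)"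
        by (simp add: \<kappa>_def complex_norm_square[symmetric])
      finally have "Q (- cnj (x $ 2)) (cnj (x $ 1)) = - of_real \<kappa> * (p + q)"
        unfolding pq by (simp add: algebra_simps)
      then show ?thesis
        using binary_form_zero[OF nz _ _ \<kappa>, of p d g q "p + q"] pq by (simp add: Q_def)
    qed
    then obtain y1 y2 where "y1 \<noteq> 0 \<or> y2 \<noteq> 0" "Q y1 y2 = 0" by blast
    then show ?thesis
      using isotropic_plane_through_kernel[OF Tc T0, of y1 y2] True by (simp add: Q_def abb)
  qed
  then show ?thesis using zero_compression_unitarily_similar unitarily_similar_sym[OF T] by blast
qed

lemma eigenvalue_mset_3:
  assumes B: "B \<in> carrier_mat 3 3" and ev: "eigenvalue_mset B = {#0, e, f#}"
  shows "det B = 0" "trace3 B = e + f"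
proof -
  have "smult (lead_coeff (char_poly B)) (\<Prod>x\<in>#proots (char_poly B). [:-x, 1:]) = char_poly B"
    by (rule complex_poly_decompose_multiset)
  moreover have "lead_coeff (char_poly B) = 1" using degree_monic_char_poly[OF B] by simp
  ultimately have *: "char_poly B = [:0, 1:] * ([:-e, 1:] * [:-f, 1:])"
    using ev by (simp add: eigenvalue_mset_def)
  show "det B = 0" "trace3 B = e + f"
    using * B by (auto simp: char_poly_3 trace3_def algebra_simps)
qed

section \<open>Reduction to an arrow matrix\<close>

lemma index_compression_sum:
  fixes A V :: "complex mat"
  assumes "A \<in> carrier_mat n n" "V \<in> carrier_mat n k" "i < k" "j < k"
  shows "(mat_adjoint V * A * V) $$ (i,j) = (\<Sum>l<n. \<Sum>m<n. cnj (V $$ (l,i)) * A $$ (l,m) * V $$ (m,j))"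
  unfolding index_compression[OF assms] using assms
  by (simp add: scalar_prod_def atLeast0LessThan sum_distrib_left sum_distrib_right)
    (auto intro!: sum.cong simp: algebra_simps)

text \<open>When the normal of the hyperplane spanned by \<open>V\<close> is moved to the first
  basis vector, the isometry gets a zero first row. What remains of it is a square isometry, hence
  unitary, and a block that a unitary matrix compresses to zero is zero.\<close>

lemma hyperplane_zero_compression:
  assumes A: "A \<in> carrier_mat (Suc m) (Suc m)" and zc: "zero_compression A m"
  obtains M where "unitarily_similar (Suc m) A M"
    "\<And>i j. i < m \<Longrightarrow> j < m \<Longrightarrow> M $$ (Suc i, Suc j) = 0"
proof -
  obtain V where V: "V \<in> carrier_mat (Suc m) m" and V1: "mat_adjoint V * V = 1\<^sub>m m"
    and V0: "mat_adjoint V * A * V = 0\<^sub>m m m"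
    using zc A by (auto simp: zero_compression_def)
  \<comment> \<open>Padding the adjoint of \<open>V\<close> with a zero row gives a singular square
    matrix; a kernel vector of it is orthogonal to all columns of \<open>V\<close>.\<close>
  define K where "K = mat (Suc m) (Suc m) (\<lambda>(i,j). if i < m then mat_adjoint V $$ (i,j) else 0)"
  have K: "K \<in> carrier_mat (Suc m) (Suc m)" by (simp add: K_def)
  have "det K = 0"
    using laplace_expansion_row[OF K, of m] by (simp add: K_def)
  then obtain v where v: "v \<in> carrier_vec (Suc m)" "v \<noteq> 0\<^sub>v (Suc m)" and Kv: "K *\<^sub>v v = 0\<^sub>v (Suc m)"
    using det_0_iff_vec_prod_zero_field[OF K] by blast
  have Vv: "mat_adjoint V *\<^sub>v v = 0\<^sub>v m"
  proof (rule eq_vecI)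
    fix i assume "i < dim_vec (0\<^sub>v m)"
    then have i: "i < m" by simp
    have "(mat_adjoint V *\<^sub>v v) $ i = (K *\<^sub>v v) $ i"
      using i V v by (simp add: K_def scalar_prod_def)
    then show "(mat_adjoint V *\<^sub>v v) $ i = 0\<^sub>v m $ i" using i by (simp add: Kv)
  qed (use V in simp)
  obtain Q where Q: "unitary_mat (Suc m) Q" and Qv: "\<And>i. 0 < i \<Longrightarrow> i < Suc m \<Longrightarrow> (Q *\<^sub>v v) $ i = 0"
    using householder[OF v(1), of 0] by (metis zero_less_Suc)
  note Qc = unitary_matD[OF Q]
  define \<beta> where "\<beta> = (Q *\<^sub>v v) $ 0"
  have Qv': "Q *\<^sub>v v = \<beta> \<cdot>\<^sub>v unit_vec (Suc m) 0"
    using Qv Qc(1) v(1) by (intro eq_vecI) (auto simp: \<beta>_def unit_vec_def)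
  have \<beta>: "\<beta> \<noteq> 0"
    using unitary_mult_vec_nonzero[OF Q v(1,2)] Qv' by auto
  define W where "W = Q * V"
  have W: "W \<in> carrier_mat (Suc m) m" using Qc V by (auto simp: W_def)
  have W0: "W $$ (0,j) = 0" if j: "j < m" for j
  proof -
    have "mat_adjoint W *\<^sub>v (Q *\<^sub>v v) = mat_adjoint V *\<^sub>v (mat_adjoint Q *\<^sub>v (Q *\<^sub>v v))"
      unfolding W_def mat_adjoint_mult[OF Qc(1) V] using Qc(1) V v(1)
      by (intro assoc_mult_mat_vec[of _ m "Suc m" _ "Suc m"]) auto
    also have "mat_adjoint Q *\<^sub>v (Q *\<^sub>v v) = v"
      using Qc v by (simp flip: assoc_mult_mat_vec[of _ "Suc m" "Suc m" _ "Suc m"])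
    finally have "(mat_adjoint W *\<^sub>v (\<beta> \<cdot>\<^sub>v unit_vec (Suc m) 0)) $ j = 0"
      using j by (simp add: Vv Qv')
    moreover have "(mat_adjoint W *\<^sub>v (\<beta> \<cdot>\<^sub>v unit_vec (Suc m) 0)) $ j = \<beta> * cnj (W $$ (0,j))"
      using j W by (simp add: scalar_prod_def unit_vec_def if_distrib cong: if_cong)
    ultimately show ?thesis using \<beta> by simp
  qed
  define M where "M = Q * A * mat_adjoint Q"
  have M: "M \<in> carrier_mat (Suc m) (Suc m)" using A Qc by (auto simp: M_def)
  have US: "unitarily_similar (Suc m) A M"
    unfolding M_def by (rule unitarily_similar_conjugate[OF A Q])
  have QMQ: "mat_adjoint Q * M * Q = A"
    using unitary_conjugation_cancel[OF unitary_mat_adjoint[OF Q] A] by (simp add: M_def)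
  have W00: "mat_adjoint W * M * W = 0\<^sub>m m m"
    unfolding W_def conjugation_assoc[OF M Qc(1) V] QMQ by (rule V0)
  have W11: "mat_adjoint W * W = 1\<^sub>m m"
  proof -
    have "mat_adjoint W * 1\<^sub>m (Suc m) * W = mat_adjoint V * (mat_adjoint Q * 1\<^sub>m (Suc m) * Q) * V"
      unfolding W_def by (rule conjugation_assoc) (use Qc V in auto)
    then show ?thesis using W V Qc V1 by simp
  qed
  define M' where "M' = mat m m (\<lambda>(i,j). M $$ (Suc i, Suc j))"
  define W' where "W' = mat m m (\<lambda>(i,j). W $$ (Suc i, j))"
  have M': "M' \<in> carrier_mat m m" and W': "W' \<in> carrier_mat m m" by (simp_all add: M'_def W'_def)
  have "mat_adjoint W' * M' * W' = 0\<^sub>m m m"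
  proof (rule eq_matI)
    fix i j assume "i < dim_row (0\<^sub>m m m)" "j < dim_col (0\<^sub>m m m)"
    then have ij: "i < m" "j < m" by simp_all
    have "(mat_adjoint W' * M' * W') $$ (i,j) = (mat_adjoint W * M * W) $$ (i,j)"
      unfolding index_compression_sum[OF M' W' ij] index_compression_sum[OF M W ij]
      using ij by (simp add: sum.lessThan_Suc_shift W0 M'_def W'_def del: sum.lessThan_Suc)
    then show "(mat_adjoint W' * M' * W') $$ (i,j) = 0\<^sub>m m m $$ (i,j)" by (simp add: W00)
  qed (use W' in simp_all)
  moreover have "mat_adjoint W' * W' = 1\<^sub>m m"
  proof (rule eq_matI)
    fix i j assume "i < dim_row (1\<^sub>m m)" "j < dim_col (1\<^sub>m m)"
    then have ij: "i < m" "j < m" by simp_all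
    have "(mat_adjoint W' * W') $$ (i,j) = (mat_adjoint W * W) $$ (i,j)"
      using ij W W' by (simp add: scalar_prod_def atLeast0LessThan sum.lessThan_Suc_shift W0 W'_def del: sum.lessThan_Suc)
    then show "(mat_adjoint W' * W') $$ (i,j) = 1\<^sub>m m $$ (i,j)" by (simp add: W11)
  qed (use W' in simp_all)
  ultimately have "zero_compression M' m"
    using M' W' by (auto simp: zero_compression_def)
  then have "M' = 0\<^sub>m m m" by (rule zero_compression_full[OF M'])
  then have "M $$ (Suc i, Suc j) = 0" if "i < m" "j < m" for i j
    using that by (metis (no_types, lifting) M'_def index_mat(1) index_zero_mat(1) split_conv)
  then show ?thesis using that US by blast
qed

text \<open>\<open>P\<close> treats \<open>u\<close> and fixes coordinate \<open>0\<close>;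
  \<open>R\<close> treats \<open>P *\<^sub>v v\<close> and fixes coordinates \<open>0\<close> and
  \<open>1\<close>. Since \<open>P *\<^sub>v u\<close> is supported on these two coordinates,
  \<open>R\<close> does not disturb it.\<close>

lemma householder_two_vectors:
  fixes u v :: "complex vec"
  assumes u: "u \<in> carrier_vec n" and v: "v \<in> carrier_vec n" and n: "n \<ge> 3"
  obtains Q where "unitary_mat n Q"
    "\<And>i. i < n \<Longrightarrow> Q $$ (i,0) = (if i = 0 then 1 else 0)"
    "\<And>j. j < n \<Longrightarrow> Q $$ (0,j) = (if j = 0 then 1 else 0)"
    "\<And>i. 1 < i \<Longrightarrow> i < n \<Longrightarrow> (Q *\<^sub>v u) $ i = 0"
    "\<And>i. 2 < i \<Longrightarrow> i < n \<Longrightarrow> (Q *\<^sub>v v) $ i = 0"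
proof -
  have n12: "1 < n" "2 < n" using n by simp_all
  obtain P where P: "unitary_mat n P" and Pu: "\<And>i. 1 < i \<Longrightarrow> i < n \<Longrightarrow> (P *\<^sub>v u) $ i = 0"
    and P0: "\<And>i j. i < n \<Longrightarrow> j < n \<Longrightarrow> i < 1 \<or> j < 1 \<Longrightarrow> P $$ (i, j) = (if i = j then 1 else 0)"
    by (rule householder[OF u n12(1)]) blast
  note Pc = unitary_matD(1)[OF P]
  have Pv: "P *\<^sub>v v \<in> carrier_vec n" using Pc v by simp
  obtain R where R: "unitary_mat n R" and Rv: "\<And>i. 2 < i \<Longrightarrow> i < n \<Longrightarrow> (R *\<^sub>v (P *\<^sub>v v)) $ i = 0"
    and R0: "\<And>i j. i < n \<Longrightarrow> j < n \<Longrightarrow> i < 2 \<or> j < 2 \<Longrightarrow> R $$ (i, j) = (if i = j then 1 else 0)"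
    by (rule householder[OF Pv n12(2)]) blast
  note Rc = unitary_matD(1)[OF R]
  have "unitary_mat n (R * P)" by (rule unitary_mat_mult[OF R P])
  moreover have "(R * P) $$ (i,0) = (if i = 0 then 1 else 0)" if "i < n" for i
  proof -
    have "(R * P) $$ (i,0) = (\<Sum>l<n. R $$ (i,l) * (if l = 0 then 1 else 0))"
      using that n Rc Pc P0 by (auto simp: scalar_prod_def atLeast0LessThan intro!: sum.cong)
    also have "\<dots> = R $$ (i,0)" using n by (simp add: if_distrib cong: if_cong)
    finally show ?thesis using R0[of i 0] that n by simp
  qed
  moreover have "(R * P) $$ (0,j) = (if j = 0 then 1 else 0)" if "j < n" for j
  proof -
    have "(R * P) $$ (0,j) = (\<Sum>l<n. R $$ (0,l) * P $$ (l,j))"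
      using that n Rc Pc by (simp add: scalar_prod_def atLeast0LessThan)
    also have "\<dots> = (\<Sum>l<n. (if l = 0 then P $$ (l,j) else 0))"
      by (rule sum.cong) (use n R0 in auto)
    also have "\<dots> = P $$ (0,j)" using n by simp
    finally show ?thesis using P0[of 0 j] that n by auto
  qed
  moreover have "((R * P) *\<^sub>v u) $ i = 0" if "1 < i" "i < n" for i
  proof -
    have "((R * P) *\<^sub>v u) $ i = (R *\<^sub>v (P *\<^sub>v u)) $ i" using Rc Pc u by simp
    also have "\<dots> = (\<Sum>l<n. R $$ (i,l) * (P *\<^sub>v u) $ l)"
      using that Rc Pc by (simp add: scalar_prod_def atLeast0LessThan)
    also have "\<dots> = 0"
    proof (rule sum.neutral, safe)
      fix l assume "l < n"
      then show "R $$ (i,l) * (P *\<^sub>v u) $ l = 0"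
        using that Pu[of l] R0[of i l] by (cases "1 < l") auto
    qed
    finally show ?thesis .
  qed
  moreover have "((R * P) *\<^sub>v v) $ i = 0" if "2 < i" "i < n" for i
    using Rv[OF that] Rc Pc v by simp
  ultimately show ?thesis using that by blast
qed

text \<open>The normal form reached by two reflections: the first leaves one entry \<open>p\<close>
  below the corner, the second leaves two entries \<open>r\<close> and \<open>s\<close> to its
  right.\<close>

definition arrow3 :: "complex \<Rightarrow> complex \<Rightarrow> complex \<Rightarrow> complex \<Rightarrow> complex mat" where
  "arrow3 c r s p = mat 3 3 (\<lambda>(i,j).
     if i = 0 then (if j = 0 then c else if j = 1 then r else s) else if i = 1 \<and> j = 0 then p else 0)"

lemma arrow3_carrier: "arrow3 c r s p \<in> carrier_mat 3 3"
  by (simp add: arrow3_def)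

text \<open>A unitary matrix fixing the first basis vector preserves the trailing zero block and
  acts on first column and first row separately, so \<open>householder_two_vectors\<close> shortens
  both.\<close>

lemma hyperplane_zero_compression_arrow3:
  assumes A: "A \<in> carrier_mat n n" and n: "n \<ge> 3" and zc: "zero_compression A (n - 1)"
  obtains c r s p where "unitarily_similar n A (diag_block_mat [arrow3 c r s p, 0\<^sub>m (n - 3) (n - 3)])"
proof -
  obtain m where m: "n = Suc m" using n by (cases n) auto
  obtain M where AM: "unitarily_similar n A M"
    and M0: "\<And>i j. i < m \<Longrightarrow> j < m \<Longrightarrow> M $$ (Suc i, Suc j) = 0"
    using hyperplane_zero_compression[of A m] A zc m by auto
  have M: "M \<in> carrier_mat n n" using AM by (simp add: unitarily_similar_def)
  have M0': "M $$ (i,j) = 0" if "i \<noteq> 0" "j \<noteq> 0" "i < n" "j < n" for i j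
    using M0[of "i - 1" "j - 1"] that m by simp
  define u where "u = col M 0"
  \<comment> \<open>The conjugate is taken because the adjoint of \<open>Q\<close> acts on the row
    from the right.\<close>
  define v where "v = conjugate (row M 0)"
  have uv: "u \<in> carrier_vec n" "v \<in> carrier_vec n" using M by (auto simp: u_def v_def intro!: carrier_vecI)
  obtain Q where Q: "unitary_mat n Q"
    and Q0: "\<And>i. i < n \<Longrightarrow> Q $$ (i,0) = (if i = 0 then 1 else 0)"
      "\<And>j. j < n \<Longrightarrow> Q $$ (0,j) = (if j = 0 then 1 else 0)"
    and Qu: "\<And>i. 1 < i \<Longrightarrow> i < n \<Longrightarrow> (Q *\<^sub>v u) $ i = 0"
    and Qv: "\<And>i. 2 < i \<Longrightarrow> i < n \<Longrightarrow> (Q *\<^sub>v v) $ i = 0"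
    using householder_two_vectors[OF uv n] by blast
  note Qc = unitary_matD(1)[OF Q]
  define N where "N = Q * M * mat_adjoint Q"
  have N: "N \<in> carrier_mat n n" using M Qc by (auto simp: N_def)
  have N_sum: "N $$ (i,j) = (\<Sum>l<n. \<Sum>k<n. Q $$ (i,l) * M $$ (l,k) * cnj (Q $$ (j,k)))" if "i < n" "j < n" for i j
    using index_compression_sum[of M n "mat_adjoint Q" n i j] that M Qc by (simp add: N_def)
  have N0: "N $$ (i,j) = 0" if "i \<noteq> 0" "j \<noteq> 0" "i < n" "j < n" for i j
    unfolding N_sum[OF that(3,4)]
  proof (intro sum.neutral ballI)
    fix l k assume "l \<in> {..<n}" "k \<in> {..<n}"
    then show "Q $$ (i,l) * M $$ (l,k) * cnj (Q $$ (j,k)) = 0"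
      using that Q0(1)[of i] Q0(1)[of j] M0'[of l k] by (cases "l = 0"; cases "k = 0") auto
  qed
  have Ncol: "N $$ (i,0) = 0" if "1 < i" "i < n" for i
  proof -
    have "N $$ (i,0) = (\<Sum>l<n. \<Sum>k<n. Q $$ (i,l) * M $$ (l,k) * cnj (Q $$ (0,k)))"
      using that n by (intro N_sum) auto
    also have "\<dots> = (\<Sum>l<n. \<Sum>k<n. (if k = 0 then Q $$ (i,l) * M $$ (l,k) else 0))"
      by (intro sum.cong refl) (use Q0(2) in auto)
    also have "\<dots> = (\<Sum>l<n. Q $$ (i,l) * M $$ (l,0))" using n by simp
    also have "\<dots> = (Q *\<^sub>v u) $ i"
      using that n M Qc by (simp add: u_def scalar_prod_def atLeast0LessThan)
    finally show ?thesis using Qu that by simp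
  qed
  have Nrow: "N $$ (0,j) = 0" if "2 < j" "j < n" for j
  proof -
    have "N $$ (0,j) = (\<Sum>l<n. \<Sum>k<n. Q $$ (0,l) * M $$ (l,k) * cnj (Q $$ (j,k)))"
      using that n by (intro N_sum) auto
    also have "\<dots> = (\<Sum>l<n. if l = 0 then (\<Sum>k<n. M $$ (l,k) * cnj (Q $$ (j,k))) else 0)"
      by (intro sum.cong refl) (use Q0(2) in auto)
    also have "\<dots> = (\<Sum>k<n. M $$ (0,k) * cnj (Q $$ (j,k)))" using n by simp
    also have "\<dots> = cnj ((Q *\<^sub>v v) $ j)"
      using that n M Qc by (simp add: v_def scalar_prod_def atLeast0LessThan mult.commute)
    finally show ?thesis using Qv that by simp
  qed
  have "N = diag_block_mat [arrow3 (N $$ (0,0)) (N $$ (0,1)) (N $$ (0,2)) (N $$ (1,0)), 0\<^sub>m (n - 3) (n - 3)]"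
    (is "N = ?D")
  proof (rule eq_matI)
    show "dim_row N = dim_row ?D" "dim_col N = dim_col ?D"
      using N n by (simp_all add: arrow3_def Let_def)
    fix i j assume "i < dim_row ?D" "j < dim_col ?D"
    then have ij: "i < n" "j < n" using n by (simp_all add: arrow3_def Let_def)
    consider "j = 0" | "j = 1" | "j = 2" | "3 \<le> j" by linarith
    then show "N $$ (i,j) = ?D $$ (i,j)"
      by cases (use ij n N0[of i j] Ncol[of i] Nrow[of j] in \<open>auto simp: arrow3_def Let_def\<close>)
  qed
  moreover have "unitarily_similar n A N"
    using unitarily_similar_trans[OF AM unitarily_similar_conjugate[OF M Q]] by (simp add: N_def)
  ultimately show ?thesis using that by metis
qed

section \<open>The numerical range of an arrow matrix\<close>

text \<open>The parametrization \<open>x \<mapsto> (2|x\<^sub>0|\<^sup>2 - 1, 2 cnj x\<^sub>0 x\<^sub>1, 2 cnj x\<^sub>0 x\<^sub>2)\<close> maps the unit sphere of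
  \<open>\<complex>\<^sup>3\<close> onto that of \<open>\<real> \<times> \<complex>\<^sup>2\<close> and turns the quadratic form of the matrix into a real linear one.\<close>

lemma numerical_range_arrow3_linear:
  "z \<in> numerical_range (arrow3 c r s p) \<longleftrightarrow>
     (\<exists>h \<zeta> \<xi>. h\<^sup>2 + (norm \<zeta>)\<^sup>2 + (norm \<xi>)\<^sup>2 = 1 \<and>
       2 * z - c = of_real h * c + r * \<zeta> + p * cnj \<zeta> + s * \<xi>)"
    (is "_ \<longleftrightarrow> ?R")
proof
  have form: "(arrow3 c r s p *\<^sub>v x) \<bullet>c x =
      c * (x $ 0 * cnj (x $ 0)) + r * (x $ 1 * cnj (x $ 0)) + s * (x $ 2 * cnj (x $ 0)) + p * (x $ 0 * cnj (x $ 1))"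
    if "x \<in> carrier_vec 3" for x
    using that by (simp add: hermitian_form_3[OF arrow3_carrier]) (simp add: arrow3_def algebra_simps)
  {
    assume "z \<in> numerical_range (arrow3 c r s p)"
    then obtain x where x: "x \<in> carrier_vec 3" "x \<bullet>c x = 1" and z: "z = (arrow3 c r s p *\<^sub>v x) \<bullet>c x"
      using arrow3_carrier[of c r s p] by (auto simp: numerical_range_def)
    define t where "t = (norm (x $ 0))\<^sup>2"
    have t: "x $ 0 * cnj (x $ 0) = of_real t" by (simp add: t_def complex_norm_square[symmetric])
    have sum1: "t + (norm (x $ 1))\<^sup>2 + (norm (x $ 2))\<^sup>2 = 1"
      using x unit_vec_3 by (simp add: t_def)
    have "(2 * t - 1)\<^sup>2 + (norm (2 * cnj (x $ 0) * x $ 1))\<^sup>2 + (norm (2 * cnj (x $ 0) * x $ 2))\<^sup>2 =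
        (2 * t - 1)\<^sup>2 + 4 * t * ((norm (x $ 1))\<^sup>2 + (norm (x $ 2))\<^sup>2)"
      by (simp add: norm_mult power_mult_distrib t_def algebra_simps)
    also have "(norm (x $ 1))\<^sup>2 + (norm (x $ 2))\<^sup>2 = 1 - t" using sum1 by simp
    also have "(2 * t - 1)\<^sup>2 + 4 * t * (1 - t) = 1" by (simp add: power2_eq_square algebra_simps)
    finally have "(2 * t - 1)\<^sup>2 + (norm (2 * cnj (x $ 0) * x $ 1))\<^sup>2 + (norm (2 * cnj (x $ 0) * x $ 2))\<^sup>2 = 1" .
    moreover have "2 * z - c = of_real (2 * t - 1) * c + r * (2 * cnj (x $ 0) * x $ 1)
        + p * cnj (2 * cnj (x $ 0) * x $ 1) + s * (2 * cnj (x $ 0) * x $ 2)"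
      unfolding z form[OF x(1)] t by (simp add: algebra_simps)
    ultimately show ?R by blast
  next
    assume ?R
    then obtain h \<zeta> \<xi> where sph: "h\<^sup>2 + (norm \<zeta>)\<^sup>2 + (norm \<xi>)\<^sup>2 = 1"
      and z: "2 * z - c = of_real h * c + r * \<zeta> + p * cnj \<zeta> + s * \<xi>" by blast
    have "h\<^sup>2 \<le> 1" using sph by (smt (verit) zero_le_power2)
    then have h: "-1 \<le> h" "h \<le> 1" by (auto simp: abs_square_le_1 abs_le_iff)
    define t where "t = sqrt ((1 + h) / 2)"
    have t2: "t * t = (1 + h) / 2" using h by (simp add: t_def)
    \<comment> \<open>A preimage with real \<open>x $ 0\<close>, the overall phase being free. If
      \<open>t = 0\<close>, then \<open>h = -1\<close> and the sphere equation forces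
      \<open>\<zeta> = 0\<close> and \<open>\<xi> = 0\<close>; the second basis vector then gives
      the required value \<open>0\<close>.\<close>
    define x where "x = (if t = 0 then vec 3 (\<lambda>i. if i = 1 then 1 else 0)
      else vec 3 (\<lambda>i. if i = 0 then of_real t else if i = 1 then \<zeta> / of_real (2 * t) else \<xi> / of_real (2 * t)))"
    have x: "x \<in> carrier_vec 3" by (simp add: x_def)
    have "x \<bullet>c x = 1 \<and> (arrow3 c r s p *\<^sub>v x) \<bullet>c x = z"
    proof (cases "t = 0")
      case True
      then have "h = -1" using t2 by simp
      then have "\<zeta> = 0" "\<xi> = 0" using sph by (simp_all add: sum_power2_eq_zero_iff)
      then have "z = 0" using z \<open>h = -1\<close> by simp
      moreover have "x $ 0 = 0" "x $ 1 = 1" "x $ 2 = 0" using True by (simp_all add: x_def)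
      ultimately show ?thesis using x by (simp add: form cscalar_prod_3)
    next
      case False
      then have xi: "x $ 0 = of_real t" "x $ 1 = \<zeta> / of_real (2 * t)" "x $ 2 = \<xi> / of_real (2 * t)"
        by (simp_all add: x_def)
      have nz: "1 + h \<noteq> 0" using t2 False by auto
      have "(norm (x $ 0))\<^sup>2 + (norm (x $ 1))\<^sup>2 + (norm (x $ 2))\<^sup>2 =
          t * t + ((norm \<zeta>)\<^sup>2 + (norm \<xi>)\<^sup>2) / (4 * (t * t))"
        unfolding xi by (simp add: norm_divide power_divide power2_eq_square add_divide_distrib)
      also have "(norm \<zeta>)\<^sup>2 + (norm \<xi>)\<^sup>2 = (1 + h) * (1 - h)"
        using sph by (simp add: power2_eq_square algebra_simps)
      also have "t * t + (1 + h) * (1 - h) / (4 * (t * t)) = 1"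
        unfolding t2 using nz by (simp add: field_simps)
      finally have "x \<bullet>c x = 1" using unit_vec_3[OF x] by simp
      have "2 * ((arrow3 c r s p *\<^sub>v x) \<bullet>c x) = 2 * of_real (t * t) * c + r * \<zeta> + p * cnj \<zeta> + s * \<xi>"
        unfolding form[OF x] xi using False by (simp add: field_simps)
      moreover have "2 * complex_of_real (t * t) = 1 + of_real h" unfolding t2 by simp
      ultimately have "2 * ((arrow3 c r s p *\<^sub>v x) \<bullet>c x) = 2 * z"
        using z by (simp add: algebra_simps)
      then show ?thesis using \<open>x \<bullet>c x = 1\<close> by simp
    qed
    then show "z \<in> numerical_range (arrow3 c r s p)"
      using x arrow3_carrier[of c r s p] unfolding numerical_range_def by force
  }
qed

lemma sum_5: "(\<Sum>j<5. f j) = f 0 + f 1 + f 2 + f 3 + f (4::nat)"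
  by (simp add: eval_nat_numeral)

text \<open>Real and imaginary parts of \<open>\<zeta>\<close> enter
  \<open>r * \<zeta> + p * cnj \<zeta>\<close> with coefficients \<open>r + p\<close> and
  \<open>\<i> * (r - p)\<close>. This produces the real weights that
  \<open>linear_image_sphere\<close> expects.\<close>

lemma numerical_range_arrow3_sphere:
  fixes c r s p :: complex
  defines "a \<equiv> (\<lambda>j. [c, r + p, \<i> * (r - p), s, \<i> * s] ! j)"
  shows "z \<in> numerical_range (arrow3 c r s p) \<longleftrightarrow>
    (\<exists>x. (\<Sum>j<5. (x j)\<^sup>2) = 1 \<and> 2 * z - c = (\<Sum>j<5. of_real (x j) * a j))"
proof -
  have a: "a 0 = c" "a (Suc 0) = r + p" "a 2 = \<i> * (r - p)" "a 3 = s" "a 4 = \<i> * s"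
    by (simp_all add: a_def)
  show ?thesis unfolding numerical_range_arrow3_linear
  proof (intro iffI; elim exE conjE)
    fix h \<zeta> \<xi>
    assume *: "h\<^sup>2 + (norm \<zeta>)\<^sup>2 + (norm \<xi>)\<^sup>2 = 1"
      "2 * z - c = of_real h * c + r * \<zeta> + p * cnj \<zeta> + s * \<xi>"
    define x where "x = (\<lambda>j. [h, Re \<zeta>, Im \<zeta>, Re \<xi>, Im \<xi>] ! j)"
    have "(\<Sum>j<5. (x j)\<^sup>2) = 1" using *(1) by (simp add: sum_5 x_def cmod_power2)
    moreover have "2 * z - c = (\<Sum>j<5. of_real (x j) * a j)"
      unfolding *(2) by (simp add: sum_5 x_def a complex_eq_iff algebra_simps)
    ultimately show "\<exists>x. (\<Sum>j<5. (x j)\<^sup>2) = 1 \<and> 2 * z - c = (\<Sum>j<5. of_real (x j) * a j)" by blast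
  next
    fix x assume *: "(\<Sum>j<5. (x j)\<^sup>2) = 1" "2 * z - c = (\<Sum>j<5. of_real (x j) * a j)"
    have "(x 0)\<^sup>2 + (norm (Complex (x 1) (x 2)))\<^sup>2 + (norm (Complex (x 3) (x 4)))\<^sup>2 = 1"
      using *(1) by (simp add: sum_5 cmod_power2)
    moreover have "2 * z - c = of_real (x 0) * c + r * Complex (x 1) (x 2) + p * cnj (Complex (x 1) (x 2))
        + s * Complex (x 3) (x 4)"
      unfolding *(2) by (simp add: sum_5 a complex_eq_iff algebra_simps)
    ultimately show "\<exists>h \<zeta> \<xi>. h\<^sup>2 + (norm \<zeta>)\<^sup>2 + (norm \<xi>)\<^sup>2 = 1 \<and>
       2 * z - c = of_real h * c + r * \<zeta> + p * cnj \<zeta> + s * \<xi>" by blast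
  qed
qed

text \<open>The sum of the \<open>(a j)\<^sup>2\<close> is \<open>c\<^sup>2 + 4 * p * r\<close>, the
  discriminant of the quadratic with roots \<open>f1\<close> and \<open>f2\<close>, hence
  \<open>(f1 - f2)\<^sup>2\<close>. With \<open>y = 2 * z - c\<close> the condition of
  \<open>linear_image_sphere\<close> becomes a bound on the squared sum of the distances to
  \<open>f1\<close> and \<open>f2\<close>.\<close>

lemma numerical_range_arrow3:
  fixes c r s p f1 f2 :: complex
  assumes f: "f1 + f2 = c" "f1 * f2 = - (p * r)"
  defines "N \<equiv> (norm c)\<^sup>2 + 2 * (norm r)\<^sup>2 + 2 * (norm p)\<^sup>2 + 2 * (norm s)\<^sup>2"
  shows "numerical_range (arrow3 c r s p) =
      {z. dist z f1 + dist z f2 \<le> sqrt ((N + (dist f1 f2)\<^sup>2) / 2)}"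
    and "(dist f1 f2)\<^sup>2 \<le> N"
proof -
  define a where "a = (\<lambda>j. [c, r + p, \<i> * (r - p), s, \<i> * s] ! j)"
  have a: "a 0 = c" "a (Suc 0) = r + p" "a 2 = \<i> * (r - p)" "a 3 = s" "a 4 = \<i> * s"
    by (simp_all add: a_def)
  define G where "G = (f1 - f2)\<^sup>2"
  have nG: "norm G = (dist f1 f2)\<^sup>2" by (simp add: G_def dist_norm norm_power)
  have "G = (f1 + f2)\<^sup>2 - 4 * (f1 * f2)" by (simp add: G_def power2_eq_square algebra_simps)
  also have "\<dots> = (\<Sum>j<5. (a j)\<^sup>2)"
    unfolding f by (simp add: sum_5 a power2_eq_square algebra_simps)
  finally have G: "(\<Sum>j<5. (a j)\<^sup>2) = G" by simp
  have N: "(\<Sum>j<5. (norm (a j))\<^sup>2) = N"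
    by (simp add: sum_5 a N_def norm_mult cmod_power2) (simp add: power2_eq_square algebra_simps)
  have "norm G \<le> (\<Sum>j<5. norm ((a j)\<^sup>2))" unfolding G[symmetric] by (rule norm_sum)
  then show "(dist f1 f2)\<^sup>2 \<le> N" using N nG by (simp add: norm_power)
  \<comment> \<open>A nontrivial real relation among the five coefficients: either \<open>s\<close>
    is itself \<open>0\<close>, or \<open>s\<close> and \<open>\<i> * s\<close> span the plane over
    the reals and express \<open>r + p\<close>.\<close>
  obtain k j0 where k: "(\<Sum>j\<in>{..<5::nat}. of_real (k j) * a j) = 0" "j0 \<in> {..<5}" "k j0 \<noteq> (0::real)"
  proof (cases "s = 0")
    case True
    then show ?thesis by (intro that[of "\<lambda>j. if j = 3 then 1 else 0" 3]) (simp_all add: sum_5 a)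
  next
    case False
    define w where "w = - (r + p) / s"
    have "of_real (Re w) * s + of_real (Im w) * (\<i> * s) = w * s"
      by (simp add: complex_eq_iff algebra_simps)
    also have "\<dots> = - (r + p)" using False by (simp add: w_def)
    finally have "of_real (Re w) * s + of_real (Im w) * (\<i> * s) = - (r + p)" .
    then show ?thesis
      by (intro that[of "\<lambda>j. [0, 1, 0, Re w, Im w] ! j" 1])
        (simp_all add: sum_5 a add.assoc)
  qed
  show "numerical_range (arrow3 c r s p) =
      {z. dist z f1 + dist z f2 \<le> sqrt ((N + (dist f1 f2)\<^sup>2) / 2)}"
  proof (rule Set.set_eqI)
    fix z
    define y where "y = 2 * z - c"
    define R where "R = dist z f1 + dist z f2"
    have R: "R \<ge> 0" by (simp add: R_def)
    have y: "y = (z - f1) + (z - f2)" unfolding y_def f(1)[symmetric] by simp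
    have "y\<^sup>2 - G = 4 * ((z - f1) * (z - f2))"
      by (simp add: y G_def power2_eq_square algebra_simps)
    then have "norm (y\<^sup>2 - G) = 4 * (norm (z - f1) * norm (z - f2))" by (simp add: norm_mult)
    \<comment> \<open>The parallelogram law for \<open>z - f1\<close> and
      \<open>z - f2\<close>.\<close>
    moreover have "(norm y)\<^sup>2 + norm G = 2 * (norm (z - f1))\<^sup>2 + 2 * (norm (z - f2))\<^sup>2"
      unfolding nG dist_norm y cmod_power2 by (simp add: power2_eq_square algebra_simps)
    ultimately have R2: "2 * R\<^sup>2 = (norm y)\<^sup>2 + norm G + norm (y\<^sup>2 - G)"
      by (simp add: R_def dist_norm power2_sum)
    have "z \<in> numerical_range (arrow3 c r s p) \<longleftrightarrow>
        (\<exists>x. (\<Sum>j<5. (x j)\<^sup>2) = 1 \<and> y = (\<Sum>j<5. of_real (x j) * a j))"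
      unfolding numerical_range_arrow3_sphere y_def a_def ..
    also have "\<dots> \<longleftrightarrow> norm (y\<^sup>2 - G) \<le> N - (norm y)\<^sup>2"
      using linear_image_sphere[OF _ k, of y] by (simp add: G N)
    also have "\<dots> \<longleftrightarrow> R\<^sup>2 \<le> (N + norm G) / 2"
    proof -
      have "a \<le> N - b \<longleftrightarrow> d \<le> (N + e) / 2" if "2 * d = b + e + a" for a b d e :: real
        using that by auto
      from this[OF R2] show ?thesis .
    qed
    also have "\<dots> \<longleftrightarrow> R \<le> sqrt ((N + norm G) / 2)"
      using R real_sqrt_le_iff[of "R\<^sup>2" "(N + norm G) / 2"] by simp
    finally show "z \<in> numerical_range (arrow3 c r s p) \<longleftrightarrow>
        z \<in> {z. dist z f1 + dist z f2 \<le> sqrt ((N + (dist f1 f2)\<^sup>2) / 2)}"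
      by (simp add: R_def nG)
  qed
qed

text \<open>The characteristic polynomial is \<open>x\<close> times a quadratic whose roots have sum
  \<open>c\<close> and product \<open>- (p * r)\<close>, which are the conditions on the foci.
  Strictness of the bound on the focal distance separates ellipse from segment.\<close>

lemma arrow3_range_and_eigenvalues:
  assumes nz: "arrow3 c r s p \<noteq> 0\<^sub>m 3 3"
  shows "(\<exists>f1 f2. elliptic_disc_with_foci (numerical_range (arrow3 c r s p)) f1 f2 \<and>
            eigenvalue_mset (arrow3 c r s p) = {#0, f1, f2#}) \<or>
    (\<exists>a b. a \<noteq> b \<and> numerical_range (arrow3 c r s p) = closed_segment a b \<and>
            eigenvalue_mset (arrow3 c r s p) = {#0, a, b#})"
proof -
  define \<delta> where "\<delta> = csqrt (c\<^sup>2 + 4 * (p * r))"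
  define f1 f2 where "f1 = (c + \<delta>) / 2" and "f2 = (c - \<delta>) / 2"
  have \<delta>: "\<delta> * \<delta> = c * c + 4 * (p * r)" by (simp add: \<delta>_def power2_csqrt flip: power2_eq_square)
  have f: "f1 + f2 = c" "f1 * f2 = - (p * r)"
  proof -
    show "f1 + f2 = c" by (simp add: f1_def f2_def field_simps)
    have "f1 * f2 = (c * c - \<delta> * \<delta>) / 4" by (simp add: f1_def f2_def field_simps)
    then show "f1 * f2 = - (p * r)" unfolding \<delta> by simp
  qed
  have "char_poly (arrow3 c r s p) = [:0, 1:] * ([:- f1, 1:] * [:- f2, 1:])"
    unfolding char_poly_3[OF arrow3_carrier] det_3[OF arrow3_carrier]
    using f by (simp add: arrow3_def) (simp add: algebra_simps)
  then have ev: "eigenvalue_mset (arrow3 c r s p) = {#0, f1, f2#}"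
    by (simp add: eigenvalue_mset_def proots_mult del: mult_pCons_left mult_pCons_right)
  define N where "N = (norm c)\<^sup>2 + 2 * (norm r)\<^sup>2 + 2 * (norm p)\<^sup>2 + 2 * (norm s)\<^sup>2"
  define S where "S = sqrt ((N + (dist f1 f2)\<^sup>2) / 2)"
  note range = numerical_range_arrow3[OF f, where s = s, folded N_def, folded S_def]
  have "dist f1 f2 \<le> S" unfolding S_def using range(2) by (intro real_le_rsqrt) simp
  then consider "dist f1 f2 < S" | "dist f1 f2 = S" by linarith
  then show ?thesis
  proof cases
    case 1
    then have "elliptic_disc_with_foci (numerical_range (arrow3 c r s p)) f1 f2"
      using range(1) by (auto simp: elliptic_disc_with_foci_def)
    then show ?thesis using ev by blast
  next
    case 2
    \<comment> \<open>Coinciding foci would make \<open>S\<close> and hence \<open>N\<close> vanish,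
      and with \<open>N\<close> the whole matrix.\<close>
    have "f1 \<noteq> f2"
    proof
      assume "f1 = f2"
      then have "N \<le> 0" using 2 by (simp add: S_def)
      then have "c = 0 \<and> r = 0 \<and> p = 0 \<and> s = 0"
        unfolding N_def by (smt (verit) zero_le_power2 zero_eq_power2 norm_eq_zero)
      then have "arrow3 c r s p = 0\<^sub>m 3 3" by (auto simp: arrow3_def intro!: eq_matI)
      then show False using nz by simp
    qed
    moreover have "numerical_range (arrow3 c r s p) = closed_segment f1 f2"
    proof -
      \<comment> \<open>As \<open>S\<close> is the focal distance, the condition is equality in the
        triangle inequality.\<close>
      have "dist z f1 + dist z f2 \<le> S \<longleftrightarrow> z \<in> closed_segment f1 f2" for z
      proof -
        have "z \<in> closed_segment f1 f2 \<longleftrightarrow> dist f1 f2 = dist f1 z + dist z f2"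
          using between[of f1 f2 z] by (simp add: between_mem_segment)
        then show ?thesis
          using 2 dist_triangle[of f1 f2 z] by (auto simp: dist_commute)
      qed
      then show ?thesis unfolding range(1) by auto
    qed
    ultimately show ?thesis using ev by blast
  qed
qed

section \<open>Combination of the two implications\<close>

lemma numerical_range_zero: "numerical_range (0\<^sub>m 3 3) = {0}"
proof -
  have "(0\<^sub>m 3 3 *\<^sub>v x) \<bullet>c x = (0 :: complex)" if "x \<in> carrier_vec 3" for x
    using that by (simp add: hermitian_form_3)
  then show ?thesis
    by (auto simp: numerical_range_def cscalar_prod_3 intro!: exI[of _ "unit_vec 3 0"])
qed

theorem theorem3p3:
  fixes n :: nat and A :: "complex mat"
  assumes "n \<ge> 3" and "A \<in> carrier_mat n n"
  shows "zero_dilation_index A = n - 1 \<longleftrightarrow>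
    (\<exists>B \<in> carrier_mat 3 3.
       unitarily_similar n A (diag_block_mat [B, 0\<^sub>m (n - 3) (n - 3)]) \<and>
       ((\<exists>f\<^sub>1 f\<^sub>2. elliptic_disc_with_foci (numerical_range B) f\<^sub>1 f\<^sub>2 \<and>
                eigenvalue_mset B = {#0, f\<^sub>1, f\<^sub>2#}) \<or>
        (\<exists>a b. a \<noteq> b \<and> numerical_range B = closed_segment a b \<and>
                eigenvalue_mset B = {#0, a, b#})))"
    (is "_ \<longleftrightarrow> (\<exists>B \<in> carrier_mat 3 3. unitarily_similar n A (?D B) \<and> ?P B)")
proof
  have idx: "zero_dilation_index A = n - 1 \<longleftrightarrow> zero_compression A (n - 1) \<and> A \<noteq> 0\<^sub>m n n"
    using assms by (intro zero_dilation_index_eq_pred_iff) auto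
  {
    assume "zero_dilation_index A = n - 1"
    then have A: "zero_compression A (n - 1)" "A \<noteq> 0\<^sub>m n n" using idx by auto
    obtain c r s p where US: "unitarily_similar n A (?D (arrow3 c r s p))"
      using hyperplane_zero_compression_arrow3[OF assms(2,1) A(1)] .
    have "arrow3 c r s p \<noteq> 0\<^sub>m 3 3"
    proof
      assume "arrow3 c r s p = 0\<^sub>m 3 3"
      then have "?D (arrow3 c r s p) = 0\<^sub>m n n"
        using assms(1) by (intro eq_matI) (auto simp: Let_def)
      then have "unitarily_similar n A (0\<^sub>m n n)" using US by simp
      then show False using A(2) by (auto simp: unitarily_similar_iff dest!: unitary_matD(1))
    qed
    then show "\<exists>B \<in> carrier_mat 3 3. unitarily_similar n A (?D B) \<and> ?P B"
      using US arrow3_range_and_eigenvalues[of c r s p]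
      by (intro bexI[OF _ arrow3_carrier[of c r s p]] conjI)
  next
    assume "\<exists>B \<in> carrier_mat 3 3. unitarily_similar n A (?D B) \<and> ?P B"
    then obtain B where B: "B \<in> carrier_mat 3 3" and US: "unitarily_similar n A (?D B)" and P: "?P B"
      by blast
    \<comment> \<open>Both alternatives are reduced to the same data: eigenvalues, symmetry of the
      range about half of \<open>f1 + f2\<close>, and \<open>B\<close> being nonzero.\<close>
    have "\<exists>f1 f2. eigenvalue_mset B = {#0, f1, f2#} \<and>
        (\<forall>z \<in> numerical_range B. f1 + f2 - z \<in> numerical_range B) \<and> B \<noteq> 0\<^sub>m 3 3"
      using P
    proof (elim disjE exE conjE)
      fix f1 f2 assume ell: "elliptic_disc_with_foci (numerical_range B) f1 f2" "eigenvalue_mset B = {#0, f1, f2#}"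
      then obtain s where s: "s > dist f1 f2" and W: "numerical_range B = {z. dist z f1 + dist z f2 \<le> s}"
        by (auto simp: elliptic_disc_with_foci_def)
      \<comment> \<open>Reflection in the center exchanges the foci.\<close>
      have "dist (f1 + f2 - z) f1 = dist z f2" "dist (f1 + f2 - z) f2 = dist z f1" for z
        by (simp_all add: dist_norm norm_minus_commute)
      then have "\<forall>z \<in> numerical_range B. f1 + f2 - z \<in> numerical_range B"
        by (simp add: W add.commute)
      moreover have "B \<noteq> 0\<^sub>m 3 3"
      proof
        assume "B = 0\<^sub>m 3 3"
        then have W0: "{z. dist z f1 + dist z f2 \<le> s} = {0}" using W numerical_range_zero by simp
        have "f1 \<in> {z. dist z f1 + dist z f2 \<le> s}" "f2 \<in> {z. dist z f1 + dist z f2 \<le> s}"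
          using s by (simp_all add: dist_commute)
        then have f0: "f1 = 0" "f2 = 0" unfolding W0 by simp_all
        \<comment> \<open>With both foci at \<open>0\<close> the disc has radius
          \<open>s / 2 > 0\<close>, so it contains a point other than \<open>0\<close>.\<close>
        then have "of_real (s / 2) \<in> {z. dist z f1 + dist z f2 \<le> s}" using s by simp
        then show False unfolding W0 using s f0 by simp
      qed
      ultimately show ?thesis using ell by blast
    next
      fix a b assume seg: "a \<noteq> b" "numerical_range B = closed_segment a b" "eigenvalue_mset B = {#0, a, b#}"
      have "a + b - z \<in> closed_segment a b" if z: "z \<in> closed_segment a b" for z
      proof -
        obtain u where u: "0 \<le> u" "u \<le> 1" "z = (1 - u) *\<^sub>R a + u *\<^sub>R b"
          using z by (auto simp: closed_segment_def)
        then have "a + b - z = (1 - (1 - u)) *\<^sub>R a + (1 - u) *\<^sub>R b" by (simp add: algebra_simps)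
        then show ?thesis using u by (auto simp: closed_segment_def intro!: exI[of _ "1 - u"])
      qed
      moreover have "B \<noteq> 0\<^sub>m 3 3"
      proof
        assume "B = 0\<^sub>m 3 3"
        then have "closed_segment a b = {0}" using seg(2) numerical_range_zero by simp
        then have "a \<in> {0}" "b \<in> {0}" by (metis ends_in_segment(1), metis ends_in_segment(2))
        then show False using seg(1) by simp
      qed
      ultimately show ?thesis using seg by auto
    qed
    then obtain f1 f2 where ev: "eigenvalue_mset B = {#0, f1, f2#}"
      and sym: "\<And>z. z \<in> numerical_range B \<Longrightarrow> f1 + f2 - z \<in> numerical_range B" and nz: "B \<noteq> 0\<^sub>m 3 3"
      by blast
    have "zero_compression B 2"
      using symmetric_range_imp_zero_compression[OF B eigenvalue_mset_3(1)[OF B ev]] sym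
      by (simp add: eigenvalue_mset_3(2)[OF B ev])
    then have "zero_compression (?D B) (2 + (n - 3))"
      by (rule zero_compression_direct_sum_zero[OF B])
    moreover have "2 + (n - 3) = n - 1" using assms(1) by simp
    ultimately have "zero_compression A (n - 1)"
      using zero_compression_unitarily_similar[OF unitarily_similar_sym[OF US]] by metis
    moreover have "A \<noteq> 0\<^sub>m n n"
    proof
      assume "A = 0\<^sub>m n n"
      then have "?D B = 0\<^sub>m n n"
        using unitarily_similar_sym[OF US] by (auto simp: unitarily_similar_iff dest!: unitary_matD(1))
      then have entry: "?D B $$ (i,j) = 0" if "i < n" "j < n" for i j using that by simp
      have "B = 0\<^sub>m 3 3"
      proof (rule eq_matI)
        fix i j assume "i < dim_row (0\<^sub>m 3 3)" "j < dim_col (0\<^sub>m 3 3)"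
        then show "B $$ (i,j) = 0\<^sub>m 3 3 $$ (i,j)"
          using entry[of i j] B assms(1) by (simp add: Let_def)
      qed (use B in simp_all)
      then show False using nz by simp
    qed
    ultimately show "zero_dilation_index A = n - 1" using idx by blast
  }
qed

end
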